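(* Let $(\mathfrak A,\mathfrak M)$ be a Cartan pair with $\mathfrak A$ unital, let $x_0\in X=\widehat{\mathfrak M}$ be a point with trivial isotropy, and let $\pi_0:\mathfrak A\to\mathcal B(H_0)$ be the (irreducible) GNS representation associated with the pure state $\rho_0(a)=E(a)(x_0)$, where $E:\mathfrak A\to\mathfrak M=C(X)$ is the faithful conditional expectation. Then the weak operator closure of $\pi_0(\mathfrak M)$ is a discrete masa (maximal abelian self-adjoint subalgebra) in $\mathcal B(H_0)$.
   Context: A masa in $\mathcal B(H_0)$ is discrete if it is the algebra of all operators diagonal with respect to some orthonormal basis of $H_0$. $(\mathfrak A,\mathfrak M)$ is a Cartan pair if $\mathfrak A$ is a separable C$^*$-algebra (here unital), $\mathfrak M$ is a maximal abelian C$^*$-subalgebra of $\mathfrak A$ (containing the unit), $\mathfrak M$ is regular, i.e. the set $\mathcal N$ of normalizers generates $\mathfrak A$ as a C$^*$-algebra, and there is a faithful conditional expectation $E:\mathfrak A\to\mathfrak M$ (it is unique). A normalizer is an element $0\ne n\in\mathfrak A$ with $n^*\mathfrak M n\subset\mathfrak M$ and $n\mathfrak M n^*\subset\mathfrak M$. With $X=\widehat{\mathfrak M}$ the Gelfand space, $\mathfrak M$ is identified with $C(X)$. For $n\in\mathcal N$, $\alpha_n$ denotes the homeomorphism from the open set $\mathrm{dom}(\alpha_n)=\{x\in X: n^*n(x)>0\}$ onto $\{x\in X: nn^*(x)>0\}$ determined by $(n^*hn)(x)=h(\alpha_n(x))\,n^*n(x)$ for $h\in C(X)$. A point $x\in X$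 has non-trivial isotropy if there is $n\in\mathcal N$ with $x\in\mathrm{dom}(\alpha_n)$, $\alpha_n(x)=x$ and $E(n)(x)=0$ (equivalently, $\alpha_n(x)=x$ but $\alpha_n$ is not the identity on any neighborhood of $x$); otherwise $x$ has trivial isotropy. *)

theory Defs
  imports "HOL-Analysis.Analysis" "HOL-Library.Complex_Order"
begin

class complex_vector = real_vector +
  fixes scaleC :: "complex \<Rightarrow> 'a \<Rightarrow> 'a"  (infixr \<open>*\<^sub>C\<close> 75)
  assumes scaleC_add_right: "c *\<^sub>C (x + y) = c *\<^sub>C x + c *\<^sub>C y"
    and scaleC_add_left: "(c + d) *\<^sub>C x = c *\<^sub>C x + d *\<^sub>C x"
    and scaleC_scaleC: "c *\<^sub>C d *\<^sub>C x = (c * d) *\<^sub>C x"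
    and scaleC_of_real: "complex_of_real r *\<^sub>C x = r *\<^sub>R x"

class complex_normed_vector = complex_vector + real_normed_vector +
  assumes norm_scaleC: "norm (c *\<^sub>C x) = cmod c * norm x"

class unital_cstar_algebra = complex_normed_vector + real_normed_algebra_1 + banach +
  fixes star :: "'a \<Rightarrow> 'a"
  assumes scaleC_mult_left: "(c *\<^sub>C x) * y = c *\<^sub>C (x * y)"
    and scaleC_mult_right: "x * (c *\<^sub>C y) = c *\<^sub>C (x * y)"
    and star_add: "star (x + y) = star x + star y"
    and star_scaleC: "star (c *\<^sub>C x) = cnj c *\<^sub>C star x"
    and star_mult: "star (x * y) = star y * star x"
    and star_star: "star (star x) = x"
    and cstar_identity: "norm (star x * x) = (norm x)\<^sup>2"

text \<open>The inner product is linear in the first and conjugate linear in the second argument.\<close>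

class complex_hilbert_space = complex_normed_vector + banach +
  fixes cinner :: "'a \<Rightarrow> 'a \<Rightarrow> complex"
  assumes cinner_add_left: "cinner (x + y) z = cinner x z + cinner y z"
    and cinner_scaleC_left: "cinner (c *\<^sub>C x) y = c * cinner x y"
    and cinner_commute: "cinner x y = cnj (cinner y x)"
    and cinner_self: "cinner x x = complex_of_real ((norm x)\<^sup>2)"

definition csubspace :: "'a::complex_vector set \<Rightarrow> bool" where
  "csubspace S \<longleftrightarrow> 0 \<in> S \<and> (\<forall>x\<in>S. \<forall>y\<in>S. x + y \<in> S) \<and> (\<forall>c. \<forall>x\<in>S. c *\<^sub>C x \<in> S)"

definition clinear_map :: "('a::complex_vector \<Rightarrow> 'b::complex_vector) \<Rightarrow> bool" where
  "clinear_map f \<longleftrightarrow> (\<forall>x y. f (x + y) = f x + f y) \<and> (\<forall>c x. f (c *\<^sub>C x) = c *\<^sub>C f x)"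

definition cstar_subalgebra :: "'a::unital_cstar_algebra set \<Rightarrow> bool" where
  "cstar_subalgebra B \<longleftrightarrow> csubspace B \<and> closed B
     \<and> (\<forall>x\<in>B. \<forall>y\<in>B. x * y \<in> B) \<and> (\<forall>x\<in>B. star x \<in> B)"

definition abelian :: "'a::unital_cstar_algebra set \<Rightarrow> bool" where
  "abelian B \<longleftrightarrow> (\<forall>x\<in>B. \<forall>y\<in>B. x * y = y * x)"

definition maximal_abelian_cstar_subalgebra :: "'a::unital_cstar_algebra set \<Rightarrow> bool" where
  "maximal_abelian_cstar_subalgebra M \<longleftrightarrow> cstar_subalgebra M \<and> abelian M
     \<and> (\<forall>B. cstar_subalgebra B \<and> abelian B \<and> M \<subseteq> B \<longrightarrow> B = M)"

definition normalizers :: "'a::unital_cstar_algebra set \<Rightarrow> 'a set" where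
  "normalizers M =
     {n. n \<noteq> 0 \<and> (\<forall>m\<in>M. star n * m * n \<in> M) \<and> (\<forall>m\<in>M. n * m * star n \<in> M)}"

definition regular_subalgebra :: "'a::unital_cstar_algebra set \<Rightarrow> bool" where
  "regular_subalgebra M \<longleftrightarrow> cstar_subalgebra hull (normalizers M) = UNIV"

definition positive_element :: "'a::unital_cstar_algebra \<Rightarrow> bool" where
  "positive_element b \<longleftrightarrow> (\<exists>a. b = star a * a)"

definition conditional_expectation ::
    "'a::unital_cstar_algebra set \<Rightarrow> ('a \<Rightarrow> 'a) \<Rightarrow> bool" where
  "conditional_expectation M E \<longleftrightarrow> clinear_map E \<and> range E \<subseteq> M \<and> (\<forall>m\<in>M. E m = m)
     \<and> (\<forall>m\<in>M. \<forall>a. E (m * a) = m * E a \<and> E (a * m) = E a * m)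
     \<and> (\<forall>a. positive_element a \<longrightarrow> positive_element (E a))"

definition faithful_conditional_expectation ::
    "'a::unital_cstar_algebra set \<Rightarrow> ('a \<Rightarrow> 'a) \<Rightarrow> bool" where
  "faithful_conditional_expectation M E \<longleftrightarrow> conditional_expectation M E
     \<and> (\<forall>a. positive_element a \<and> E a = 0 \<longrightarrow> a = 0)"

definition cartan_pair :: "'a::unital_cstar_algebra set \<Rightarrow> bool" where
  "cartan_pair M \<longleftrightarrow> separable_space (euclidean :: 'a topology)
     \<and> 1 \<in> M \<and> maximal_abelian_cstar_subalgebra M \<and> regular_subalgebra M
     \<and> (\<exists>E. faithful_conditional_expectation M E)"

text \<open>
  A character of \<open>M\<close> is a function on the ambient algebra, made unique by requiring the value
  \<open>undefined\<close> outside \<open>M\<close>.  The element \<open>h \<in> M\<close> corresponds to the continuous function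
  \<open>x \<mapsto> x h\<close> on the Gelfand space, so that \<open>h(x)\<close> is written \<open>x h\<close>.
\<close>

definition characters :: "'a::unital_cstar_algebra set \<Rightarrow> ('a \<Rightarrow> complex) set" where
  "characters M = {x \<in> extensional M.
     (\<forall>h\<in>M. \<forall>k\<in>M. x (h + k) = x h + x k) \<and> (\<forall>c. \<forall>h\<in>M. x (c *\<^sub>C h) = c * x h)
     \<and> (\<forall>h\<in>M. \<forall>k\<in>M. x (h * k) = x h * x k) \<and> (\<exists>h\<in>M. x h \<noteq> 0)}"

definition gelfand_space :: "'a::unital_cstar_algebra set \<Rightarrow> ('a \<Rightarrow> complex) topology" where
  "gelfand_space M = subtopology (product_topology (\<lambda>_. euclidean) M) (characters M)"

definition alpha_dom :: "'a::unital_cstar_algebra set \<Rightarrow> 'a \<Rightarrow> ('a \<Rightarrow> complex) set" where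
  "alpha_dom M n = {x \<in> topspace (gelfand_space M). x (star n * n) > 0}"

definition alpha_ran :: "'a::unital_cstar_algebra set \<Rightarrow> 'a \<Rightarrow> ('a \<Rightarrow> complex) set" where
  "alpha_ran M n = {x \<in> topspace (gelfand_space M). x (n * star n) > 0}"

text \<open>
  Meaningful for a normalizer \<open>n\<close> and \<open>x \<in> alpha_dom M n\<close> only; see \<open>alpha_eq\<close>
  and \<open>homeomorphic_map_alpha\<close> below.
\<close>

definition alpha ::
    "'a::unital_cstar_algebra set \<Rightarrow> 'a \<Rightarrow> ('a \<Rightarrow> complex) \<Rightarrow> ('a \<Rightarrow> complex)" where
  "alpha M n x = (THE y. y \<in> topspace (gelfand_space M)
     \<and> (\<forall>h\<in>M. x (star n * h * n) = y h * x (star n * n)))"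

definition nontrivial_isotropy ::
    "'a::unital_cstar_algebra set \<Rightarrow> ('a \<Rightarrow> 'a) \<Rightarrow> ('a \<Rightarrow> complex) \<Rightarrow> bool" where
  "nontrivial_isotropy M E x \<longleftrightarrow>
     (\<exists>n\<in>normalizers M. x \<in> alpha_dom M n \<and> alpha M n x = x \<and> x (E n) = 0)"

definition trivial_isotropy ::
    "'a::unital_cstar_algebra set \<Rightarrow> ('a \<Rightarrow> 'a) \<Rightarrow> ('a \<Rightarrow> complex) \<Rightarrow> bool" where
  "trivial_isotropy M E x \<longleftrightarrow> \<not> nontrivial_isotropy M E x"

lemma topspace_gelfand_space: "topspace (gelfand_space M) = characters M"
  by (auto simp: gelfand_space_def characters_def PiE_def)

lemma alpha_eq:
  assumes M: "cstar_subalgebra M" "abelian M" "1 \<in> M"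
    and n: "n \<in> normalizers M" and x: "x \<in> alpha_dom M n"
  shows "alpha M n x = restrict (\<lambda>h. x (star n * h * n) / x (star n * n)) M"
    and "alpha M n x \<in> alpha_ran M n"
    and "h \<in> M \<Longrightarrow> x (star n * h * n) = alpha M n x h * x (star n * n)"
proof -
  let ?y = "restrict (\<lambda>h. x (star n * h * n) / x (star n * n)) M"
  have xc: "x \<in> characters M" and pos: "x (star n * n) > 0"
    using x by (auto simp: alpha_dom_def topspace_gelfand_space)
  have add: "x (h + k) = x h + x k" and mult: "x (h * k) = x h * x k" and
    scale: "x (c *\<^sub>C h) = c * x h" if "h \<in> M" "k \<in> M" for h k c
    using xc that by (auto simp: characters_def)
  have N: "star n * h * n \<in> M" "n * h * star n \<in> M" if "h \<in> M" for h
    using n that by (auto simp: normalizers_def)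
  have Mcl: "h + k \<in> M" "h * k \<in> M" "c *\<^sub>C h \<in> M" "h * k = k * h" if "h \<in> M" "k \<in> M" for h k c
    using M that by (auto simp: cstar_subalgebra_def csubspace_def abelian_def)
  have nn: "star n * n \<in> M" "n * star n \<in> M"
    using N[OF \<open>1 \<in> M\<close>] by simp_all
  have ne: "x (star n * n) \<noteq> 0" using pos by auto
  have prod: "x (star n * (h * k) * n) * x (star n * n) = x (star n * h * n) * x (star n * k * n)"
    if "h \<in> M" "k \<in> M" for h k
  proof -
    have "(star n * (h * k) * n) * (star n * n) = star n * h * (k * (n * star n)) * n"
      by (simp add: mult.assoc)
    also have "\<dots> = star n * h * ((n * star n) * k) * n"
      using Mcl(4)[OF that(2) nn(2)] by simp
    also have "\<dots> = (star n * h * n) * (star n * k * n)"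
      by (simp add: mult.assoc)
    finally have "x (star n * (h * k) * n * (star n * n)) = x (star n * h * n * (star n * k * n))"
      by simp
    then show ?thesis
      using mult[OF N(1)[OF Mcl(2)[OF that]] nn(1)] mult[OF N(1)[OF that(1)] N(1)[OF that(2)]]
      by simp
  qed
  have "?y 1 \<noteq> 0" using M(3) ne by simp
  have "?y \<in> characters M"
    unfolding characters_def
  proof (intro CollectI conjI ballI allI)
    show "?y \<in> extensional M" by simp
    fix h k assume h: "h \<in> M" and k: "k \<in> M"
    have "star n * (h + k) * n = star n * h * n + star n * k * n"
      by (simp add: distrib_left distrib_right)
    then show "?y (h + k) = ?y h + ?y k"
      using h k Mcl N add by (simp add: add_divide_distrib)
    show "?y (h * k) = ?y h * ?y k"
      using prod[OF h k] ne h k Mcl by (simp add: field_simps)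
  next
    fix c h assume h: "h \<in> M"
    have "star n * (c *\<^sub>C h) * n = c *\<^sub>C (star n * h * n)"
      by (simp add: scaleC_mult_left scaleC_mult_right)
    then show "?y (c *\<^sub>C h) = c * ?y h"
      using h Mcl N scale by simp
  next
    show "\<exists>h\<in>M. ?y h \<noteq> 0" using \<open>?y 1 \<noteq> 0\<close> M(3) by blast
  qed
  then show eq: "alpha M n x = ?y"
    unfolding alpha_def topspace_gelfand_space
  proof (intro the_equality conjI)
    fix y assume y: "y \<in> characters M \<and> (\<forall>h\<in>M. x (star n * h * n) = y h * x (star n * n))"
    show "y = ?y"
    proof (rule extensionalityI[where A = M])
      show "y \<in> extensional M" using y by (simp add: characters_def)
    qed (use y ne in \<open>auto\<close>)
  qed (use ne in auto)
  have "star n * (n * star n) * n = (star n * n) * (star n * n)" by (simp add: mult.assoc)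
  then have "?y (n * star n) = x (star n * n)" using nn mult ne by simp
  then show "alpha M n x \<in> alpha_ran M n"
    using \<open>?y \<in> characters M\<close> pos eq by (simp add: alpha_ran_def topspace_gelfand_space)
  show "h \<in> M \<Longrightarrow> x (star n * h * n) = alpha M n x h * x (star n * n)"
    using eq ne by simp
qed

lemma star_normalizer:
  fixes n :: "'a::unital_cstar_algebra"
  assumes "n \<in> normalizers M" shows "star n \<in> normalizers M"
proof -
  have "star 0 + star 0 = (star 0 :: 'a)"
    using star_add[of "0::'a" 0] by simp
  then have "star n \<noteq> 0"
    using assms star_star[of n] by (auto simp: normalizers_def)
  then show ?thesis
    using assms by (simp add: normalizers_def star_star)
qed

lemma alpha_star_alpha:
  assumes M: "cstar_subalgebra M" "abelian M" "1 \<in> M"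
    and n: "n \<in> normalizers M" and x: "x \<in> alpha_dom M n"
  shows "alpha M (star n) (alpha M n x) = x"
proof -
  let ?y = "alpha M n x"
  have xc: "x \<in> characters M" and ne: "x (star n * n) \<noteq> 0"
    using x by (auto simp: alpha_dom_def topspace_gelfand_space)
  have mult: "x (h * k) = x h * x k" if "h \<in> M" "k \<in> M" for h k
    using xc that by (auto simp: characters_def)
  have N: "star n * h * n \<in> M" "n * h * star n \<in> M" if "h \<in> M" for h
    using n that by (auto simp: normalizers_def)
  have Mcl: "h * k \<in> M" if "h \<in> M" "k \<in> M" for h k
    using M that by (auto simp: cstar_subalgebra_def)
  have nn: "star n * n \<in> M" "n * star n \<in> M"
    using N[OF \<open>1 \<in> M\<close>] by simp_all
  have y: "?y \<in> alpha_dom M (star n)"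
    using alpha_eq(2)[OF M n x] by (simp add: alpha_dom_def alpha_ran_def star_star)
  note yeq = alpha_eq(1)[OF M n x]
  have 1: "?y (n * h * star n) = x (star n * n) * x h" if "h \<in> M" for h
  proof -
    have "star n * (n * h * star n) * n = (star n * n) * h * (star n * n)"
      by (simp add: mult.assoc)
    then show ?thesis
      using that mult Mcl N nn ne yeq by simp
  qed
  have "star n * (n * star n) * n = (star n * n) * (star n * n)" by (simp add: mult.assoc)
  then have 2: "?y (n * star n) = x (star n * n)"
    using nn mult ne yeq by simp
  show ?thesis
  proof (rule extensionalityI[where A = M])
    show "alpha M (star n) ?y \<in> extensional M"
      by (simp add: alpha_eq(1)[OF M star_normalizer[OF n] y])
    show "x \<in> extensional M" using xc by (simp add: characters_def)
  qed (simp add: alpha_eq(1)[OF M star_normalizer[OF n] y] star_star 1 2 ne)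
qed

lemma continuous_map_alpha:
  assumes M: "cstar_subalgebra M" "abelian M" "1 \<in> M" and n: "n \<in> normalizers M"
  shows "continuous_map (subtopology (gelfand_space M) (alpha_dom M n))
           (subtopology (gelfand_space M) (alpha_ran M n)) (alpha M n)"
proof -
  let ?D = "subtopology (gelfand_space M) (alpha_dom M n)"
  have top: "topspace ?D = alpha_dom M n"
    by (auto simp: alpha_dom_def)
  have N: "star n * h * n \<in> M" if "h \<in> M" for h
    using n that by (auto simp: normalizers_def)
  have nn: "star n * n \<in> M" using N[OF M(3)] by simp
  have ev: "continuous_map ?D euclidean (\<lambda>x. x h)" if "h \<in> M" for h
    unfolding gelfand_space_def
    using continuous_map_product_projection[OF that, of "\<lambda>_. euclidean :: complex topology"]
    by (intro continuous_map_from_subtopology)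
  have "continuous_map ?D (product_topology (\<lambda>_. euclidean) M)
      (\<lambda>x. restrict (\<lambda>h. x (star n * h * n) / x (star n * n)) M)"
    unfolding continuous_map_componentwise
  proof (intro conjI ballI)
    fix h assume h: "h \<in> M"
    have "continuous_map ?D euclidean (\<lambda>x. x (star n * h * n) / x (star n * n))"
      unfolding divide_inverse continuous_map_atin
    proof
      fix x assume x: "x \<in> topspace ?D"
      have "((\<lambda>x. x (star n * h * n)) \<longlongrightarrow> x (star n * h * n)) (atin ?D x)"
        "((\<lambda>x. x (star n * n)) \<longlongrightarrow> x (star n * n)) (atin ?D x)"
        using ev[OF N[OF h]] ev[OF nn] x by (auto simp: continuous_map_atin)
      moreover have "x (star n * n) \<noteq> 0" using x by (auto simp: top alpha_dom_def)
      ultimately show "limitin euclidean (\<lambda>x. x (star n * h * n) * inverse (x (star n * n)))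
          (x (star n * h * n) * inverse (x (star n * n))) (atin ?D x)"
        by (auto intro!: tendsto_intros)
    qed
    then show "continuous_map ?D euclidean
        (\<lambda>x. restrict (\<lambda>h. x (star n * h * n) / x (star n * n)) M h)"
      using h by simp
  qed auto
  then have "continuous_map ?D (product_topology (\<lambda>_. euclidean) M) (alpha M n)"
    by (rule continuous_map_eq) (simp add: top alpha_eq(1)[OF M n])
  then have "continuous_map ?D (gelfand_space M) (alpha M n)"
    using alpha_eq(2)[OF M n]
    unfolding gelfand_space_def[of M] continuous_map_in_subtopology
    by (auto simp: gelfand_space_def[symmetric] top alpha_ran_def topspace_gelfand_space
        simp del: topspace_subtopology)
  then show ?thesis
    using alpha_eq(2)[OF M n]
    by (auto simp: continuous_map_in_subtopology top simp del: topspace_subtopology)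
qed

lemma homeomorphic_map_alpha:
  assumes M: "cstar_subalgebra M" "abelian M" "1 \<in> M" and n: "n \<in> normalizers M"
  shows "homeomorphic_map (subtopology (gelfand_space M) (alpha_dom M n))
           (subtopology (gelfand_space M) (alpha_ran M n)) (alpha M n)"
proof -
  note n' = star_normalizer[OF n]
  have sw: "alpha_dom M (star n) = alpha_ran M n" "alpha_ran M (star n) = alpha_dom M n"
    by (simp_all add: alpha_dom_def alpha_ran_def star_star)
  have "homeomorphic_maps (subtopology (gelfand_space M) (alpha_dom M n))
      (subtopology (gelfand_space M) (alpha_ran M n)) (alpha M n) (alpha M (star n))"
    unfolding homeomorphic_maps_def
    using continuous_map_alpha[OF M n] continuous_map_alpha[OF M n']
      alpha_star_alpha[OF M n] alpha_star_alpha[OF M n']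
    by (auto simp: sw star_star)
  then show ?thesis by (auto simp: homeomorphic_map_maps)
qed

definition bounded_operators :: "('h::complex_hilbert_space \<Rightarrow> 'h) set" where
  "bounded_operators = {T. clinear_map T \<and> (\<exists>K. \<forall>x. norm (T x) \<le> K * norm x)}"

definition is_adjoint_of ::
    "('h::complex_hilbert_space \<Rightarrow> 'h) \<Rightarrow> ('h \<Rightarrow> 'h) \<Rightarrow> bool" where
  "is_adjoint_of S T \<longleftrightarrow> (\<forall>x y. cinner (T x) y = cinner x (S y))"

definition selfadjoint_operator_algebra ::
    "('h::complex_hilbert_space \<Rightarrow> 'h) set \<Rightarrow> bool" where
  "selfadjoint_operator_algebra D \<longleftrightarrow> D \<subseteq> bounded_operators \<and> (\<lambda>x. 0) \<in> D
     \<and> (\<forall>S\<in>D. \<forall>T\<in>D. (\<lambda>x. S x + T x) \<in> D) \<and> (\<forall>c. \<forall>T\<in>D. (\<lambda>x. c *\<^sub>C T x) \<in> D)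
     \<and> (\<forall>S\<in>D. \<forall>T\<in>D. S \<circ> T \<in> D) \<and> (\<forall>T\<in>D. \<exists>S\<in>D. is_adjoint_of S T)"

definition commuting_operators :: "('h::complex_hilbert_space \<Rightarrow> 'h) set \<Rightarrow> bool" where
  "commuting_operators D \<longleftrightarrow> (\<forall>S\<in>D. \<forall>T\<in>D. S \<circ> T = T \<circ> S)"

definition masa :: "('h::complex_hilbert_space \<Rightarrow> 'h) set \<Rightarrow> bool" where
  "masa D \<longleftrightarrow> selfadjoint_operator_algebra D \<and> commuting_operators D
     \<and> (\<forall>F. selfadjoint_operator_algebra F \<and> commuting_operators F \<and> D \<subseteq> F \<longrightarrow> F = D)"

definition orthonormal_basis :: "'h::complex_hilbert_space set \<Rightarrow> bool" where
  "orthonormal_basis B \<longleftrightarrow> (\<forall>e\<in>B. norm e = 1)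
     \<and> (\<forall>e\<in>B. \<forall>f\<in>B. e \<noteq> f \<longrightarrow> cinner e f = 0) \<and> closure (csubspace hull B) = UNIV"

definition diagonal_operators ::
    "'h::complex_hilbert_space set \<Rightarrow> ('h \<Rightarrow> 'h) set" where
  "diagonal_operators B = {T \<in> bounded_operators. \<forall>e\<in>B. \<exists>c. T e = c *\<^sub>C e}"

definition discrete_masa :: "('h::complex_hilbert_space \<Rightarrow> 'h) set \<Rightarrow> bool" where
  "discrete_masa D \<longleftrightarrow> masa D \<and> (\<exists>B. orthonormal_basis B \<and> D = diagonal_operators B)"

text \<open>The coarsest topology making all matrix coefficients \<open>T \<mapsto> cinner (T x) y\<close> continuous.\<close>

definition weak_operator_topology :: "('h::complex_hilbert_space \<Rightarrow> 'h) topology" where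
  "weak_operator_topology = pullback_topology bounded_operators
     (\<lambda>T. \<lambda>(x, y). cinner (T x) y) (product_topology (\<lambda>_. euclidean) UNIV)"

definition star_representation ::
    "('a::unital_cstar_algebra \<Rightarrow> 'h::complex_hilbert_space \<Rightarrow> 'h) \<Rightarrow> bool" where
  "star_representation \<pi> \<longleftrightarrow> range \<pi> \<subseteq> bounded_operators \<and> \<pi> 1 = id
     \<and> (\<forall>a b. \<pi> (a + b) = (\<lambda>x. \<pi> a x + \<pi> b x)) \<and> (\<forall>c a. \<pi> (c *\<^sub>C a) = (\<lambda>x. c *\<^sub>C \<pi> a x))
     \<and> (\<forall>a b. \<pi> (a * b) = \<pi> a \<circ> \<pi> b) \<and> (\<forall>a. is_adjoint_of (\<pi> (star a)) (\<pi> a))"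

text \<open>
  GNS triples for the state \<open>\<rho>\<close>: a representation with a cyclic vector implementing \<open>\<rho>\<close>,
  which determines it up to unitary equivalence.
\<close>

definition gns_representation ::
    "('a::unital_cstar_algebra \<Rightarrow> complex)
       \<Rightarrow> ('a \<Rightarrow> 'h::complex_hilbert_space \<Rightarrow> 'h) \<Rightarrow> 'h \<Rightarrow> bool" where
  "gns_representation \<rho> \<pi> \<xi> \<longleftrightarrow> star_representation \<pi>
     \<and> closure (range (\<lambda>a. \<pi> a \<xi>)) = UNIV \<and> (\<forall>a. \<rho> a = cinner (\<pi> a \<xi>) \<xi>)"

end

theory Submission
  imports Defs
begin

text \<open>
  Write \<open>\<xi>\<close> for the cyclic vector and \<open>\<pi>\<close> for the representation. For a normalizer \<open>n\<close> the
  relation \<open>n\<^sup>* h n (x\<^sub>0) = h(\<alpha>\<^sub>n(x\<^sub>0)) n\<^sup>* n (x\<^sub>0)\<close> says that \<open>\<pi>(n)\<xi>\<close>, unless it vanishes, is a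
  joint eigenvector of \<open>\<pi>(M)\<close> with eigencharacter \<open>\<alpha>\<^sub>n(x\<^sub>0)\<close> (\<open>normalizer_vector_eigenvector\<close>).
  Hence the vectors belonging to different points of the orbit of \<open>x\<^sub>0\<close> are orthogonal. By
  regularity of \<open>M\<close> all these vectors together span a dense subspace
  (\<open>normalizer_vectors_total\<close>).

  Trivial isotropy makes the eigenspaces one-dimensional. If \<open>\<alpha>\<^sub>n(x\<^sub>0) = \<alpha>\<^sub>m(x\<^sub>0)\<close>, then
  \<open>k = m\<^sup>* n\<close> is a normalizer with \<open>\<alpha>\<^sub>k(x\<^sub>0) = x\<^sub>0\<close>, so \<open>E(k)(x\<^sub>0) \<noteq> 0\<close>. The element \<open>k E(k)\<close>
  commutes with \<open>M\<close>, because \<open>\<alpha>\<^sub>k\<close> is the identity wherever \<open>E(k)\<close> does not vanish on its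
  domain; so it lies in the maximal abelian algebra \<open>M\<close> and equals \<open>E(k E(k)) = E(k)\<^sup>2\<close>.
  Evaluated at \<open>\<xi>\<close>, this gives \<open>\<pi>(k)\<xi> = E(k)(x\<^sub>0) \<xi>\<close>, and applying \<open>\<pi>(m)\<close> shows that \<open>\<pi>(n)\<xi>\<close> is
  a multiple of \<open>\<pi>(m)\<xi>\<close> (\<open>normalizer_vectors_proportional\<close>). Choosing one unit vector for each
  point of the orbit yields an orthonormal basis \<open>B\<close> of joint eigenvectors with pairwise
  different eigencharacters.

  It remains to see that, for such a basis, the weak operator closure of \<open>\<pi>(M)\<close> consists of all
  operators that are diagonal with respect to \<open>B\<close> (these form a masa). Diagonality is a closed
  condition. Conversely, on finitely many basis vectors a diagonal operator \<open>T\<close> with bound \<open>K\<close>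
  agrees with some \<open>\<pi>(h)\<close>, \<open>h \<in> M\<close>, that has the same bound \<open>K\<close> (\<open>bounded_interpolation\<close>):
  numbers in the unit disc are midpoints of numbers of modulus 1, and values of modulus 1 are
  taken by unitaries \<open>exp(\<i>a)\<close> with \<open>a\<close> selfadjoint in \<open>M\<close>. As the bound does not depend on the
  finite set, this gives approximation of \<open>T\<close> on arbitrary vectors.
\<close>

section \<open>Complex linear maps, inner products and bounded operators\<close>

lemma scaleC_one [simp]: "1 *\<^sub>C (x::'a::complex_vector) = x"
  using scaleC_of_real[of 1 x] by simp

lemma scaleC_zero_left [simp]: "0 *\<^sub>C (x::'a::complex_vector) = 0"
  using scaleC_of_real[of 0 x] by simp

lemma scaleC_zero_right [simp]: "c *\<^sub>C (0::'a::complex_vector) = 0"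
  using scaleC_add_right[of c 0 "0::'a"] by simp

lemma scaleC_minus_one: "(-1) *\<^sub>C (x::'a::complex_vector) = - x"
  using scaleC_of_real[of "-1" x] by simp

lemma scaleC_minus_right: "c *\<^sub>C (- x) = - (c *\<^sub>C (x::'a::complex_vector))"
  using scaleC_add_right[of c x "- x"] by (simp add: eq_neg_iff_add_eq_0 add.commute)

lemma scaleC_diff_right: "c *\<^sub>C (x - y) = c *\<^sub>C x - c *\<^sub>C (y::'a::complex_vector)"
  using scaleC_add_right[of c x "- y"] by (simp add: scaleC_minus_right)

lemma clinear_map_add: "clinear_map f \<Longrightarrow> f (x + y) = f x + f y"
  and clinear_map_scaleC: "clinear_map f \<Longrightarrow> f (c *\<^sub>C x) = c *\<^sub>C f x"
  by (auto simp: clinear_map_def)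

lemma clinear_map_zero: "clinear_map f \<Longrightarrow> f 0 = 0"
  using clinear_map_scaleC[of f 0 0] by simp

lemma clinear_map_minus: "clinear_map f \<Longrightarrow> f (- x) = - f x"
  using clinear_map_scaleC[of f "-1" x] by (simp add: scaleC_minus_one)

lemma clinear_map_diff: "clinear_map f \<Longrightarrow> f (x - y) = f x - f y"
  using clinear_map_add[of f x "- y"] by (simp add: clinear_map_minus)

lemma clinear_map_imp_bounded_linear:
  fixes f :: "'a::complex_normed_vector \<Rightarrow> 'b::complex_normed_vector"
  assumes "clinear_map f" "\<And>x. norm (f x) \<le> K * norm x"
  shows "bounded_linear f"
  using assms clinear_map_scaleC[OF assms(1), of "complex_of_real _"]
  by (intro bounded_linear_intro[where K = K])
    (auto simp: clinear_map_add scaleC_of_real mult.commute)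

lemma csubspaceD:
  assumes "csubspace S"
  shows "0 \<in> S" "x \<in> S \<Longrightarrow> y \<in> S \<Longrightarrow> x + y \<in> S" "x \<in> S \<Longrightarrow> c *\<^sub>C x \<in> S"
    "x \<in> S \<Longrightarrow> y \<in> S \<Longrightarrow> x - y \<in> S" "x \<in> S \<Longrightarrow> r *\<^sub>R x \<in> S"
proof -
  show 1: "0 \<in> S" "x \<in> S \<Longrightarrow> c *\<^sub>C x \<in> S"  "x \<in> S \<Longrightarrow> y \<in> S \<Longrightarrow> x + y \<in> S" for x y c
    using assms by (auto simp: csubspace_def)
  show "x \<in> S \<Longrightarrow> y \<in> S \<Longrightarrow> x - y \<in> S" for x y
    using 1(3)[of x "- y"] 1(2)[of y "-1"] by (simp add: scaleC_minus_one)
  show "x \<in> S \<Longrightarrow> r *\<^sub>R x \<in> S"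
    using 1(2)[of x "complex_of_real r"] by (simp add: scaleC_of_real)
qed

lemma bounded_linear_scaleC: "bounded_linear (\<lambda>x::'a::complex_normed_vector. c *\<^sub>C x)"
  by (rule clinear_map_imp_bounded_linear[where K = "cmod c"])
    (auto simp: clinear_map_def scaleC_add_right scaleC_scaleC norm_scaleC mult.commute)

lemma bounded_linear_scaleC_left:
  "bounded_linear (\<lambda>c. c *\<^sub>C (x::'a::complex_normed_vector))"
  by (rule bounded_linear_intro[where K = "norm x"])
    (auto simp: scaleC_add_left norm_scaleC scaleC_of_real[symmetric] scaleC_scaleC
      scaleR_conv_of_real)

lemma csubspace_closure:
  fixes S :: "'a::complex_normed_vector set"
  assumes "csubspace S" shows "csubspace (closure S)"
  unfolding csubspace_def
proof (intro conjI ballI allI)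
  show "0 \<in> closure S" using csubspaceD(1)[OF assms] closure_subset by blast
next
  fix x y assume "x \<in> closure S" "y \<in> closure S"
  then obtain f g where "\<And>n. f n \<in> S" "f \<longlonglongrightarrow> x" "\<And>n. g n \<in> S" "g \<longlonglongrightarrow> y"
    unfolding closure_sequential by metis
  then show "x + y \<in> closure S"
    unfolding closure_sequential
    by (intro exI[of _ "\<lambda>n. f n + g n"] conjI allI csubspaceD(2)[OF assms] tendsto_add)
next
  fix c x assume "x \<in> closure S"
  then obtain f where "\<And>n. f n \<in> S" "f \<longlonglongrightarrow> x"
    unfolding closure_sequential by metis
  then show "c *\<^sub>C x \<in> closure S"
    unfolding closure_sequential
    by (intro exI[of _ "\<lambda>n. c *\<^sub>C f n"] conjI allI csubspaceD(3)[OF assms]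
        bounded_linear.tendsto[OF bounded_linear_scaleC])
qed

lemma closed_csubspace_sums:
  fixes S :: "'a::complex_normed_vector set"
  assumes "csubspace S" "closed S" "\<And>n. f n \<in> S" "f sums s"
  shows "s \<in> S"
proof -
  have "(\<Sum>k<n. f k) \<in> S" for n
    by (induction n) (auto intro: csubspaceD[OF assms(1)] assms(3))
  then show ?thesis
    using closed_sequentially[OF assms(2), of "\<lambda>n. \<Sum>k<n. f k" s] assms(4)
    unfolding sums_def by blast
qed

lemma cinner_add_right: "cinner (x::'h::complex_hilbert_space) (y + z) = cinner x y + cinner x z"
  using cinner_commute[of x] cinner_add_left[of y z x] by simp

lemma cinner_scaleC_right: "cinner (x::'h::complex_hilbert_space) (c *\<^sub>C y) = cnj c * cinner x y"
  using cinner_commute[of x] cinner_scaleC_left[of c y x] by simp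

lemma cinner_zero_left [simp]: "cinner 0 (x::'h::complex_hilbert_space) = 0"
  using cinner_scaleC_left[of 0 0 x] by simp

lemma cinner_zero_right [simp]: "cinner (x::'h::complex_hilbert_space) 0 = 0"
  using cinner_commute[of x 0] by simp

lemma cinner_diff_left: "cinner (x - y) (z::'h::complex_hilbert_space) = cinner x z - cinner y z"
  using cinner_add_left[of "x - y" y z] by simp

lemma cinner_self_eq_0: "cinner x (x::'h::complex_hilbert_space) = 0 \<longleftrightarrow> x = 0"
  by (simp add: cinner_self)

lemma Cauchy_Schwarz: "cmod (cinner x (y::'h::complex_hilbert_space)) \<le> norm x * norm y"
proof (cases "y = 0")
  case False
  define c where "c = cinner x y / complex_of_real ((norm y)\<^sup>2)"
  define r where "r = (cmod (cinner x y))\<^sup>2 / (norm y)\<^sup>2"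
  have c: "cinner y (x - c *\<^sub>C y) = 0"
    using False cinner_diff_left[of x "c *\<^sub>C y" y]
    by (subst cinner_commute) (simp add: c_def cinner_scaleC_left cinner_self cinner_diff_left)
  have "complex_of_real ((norm (x - c *\<^sub>C y))\<^sup>2) = cinner (x - c *\<^sub>C y) (x - c *\<^sub>C y)"
    by (simp add: cinner_self)
  also have "\<dots> = cinner x (x - c *\<^sub>C y)"
    using c by (simp add: cinner_diff_left cinner_scaleC_left)
  also have "\<dots> = complex_of_real ((norm x)\<^sup>2) - cnj c * cinner x y"
    by (subst cinner_commute) (simp add: cinner_diff_left cinner_scaleC_left cinner_self
      cinner_commute[of y x])
  also have "cnj c * cinner x y = complex_of_real r"
    using complex_norm_square[of "cinner x y"] by (simp add: c_def r_def mult.commute)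
  finally have "complex_of_real ((norm (x - c *\<^sub>C y))\<^sup>2) = complex_of_real ((norm x)\<^sup>2 - r)"
    by simp
  then have "(norm (x - c *\<^sub>C y))\<^sup>2 = (norm x)\<^sup>2 - r"
    unfolding of_real_eq_iff .
  then have "r \<le> (norm x)\<^sup>2"
    using zero_le_power2[of "norm (x - c *\<^sub>C y)"] by linarith
  then have "(cmod (cinner x y))\<^sup>2 \<le> (norm x * norm y)\<^sup>2"
    using False by (simp add: r_def divide_le_eq power_mult_distrib)
  then show ?thesis by (rule power2_le_imp_le) simp
qed simp

lemma bounded_linear_cinner_left: "bounded_linear (\<lambda>x. cinner x (y::'h::complex_hilbert_space))"
  by (rule bounded_linear_intro[where K = "norm y"])
    (auto simp: cinner_add_left Cauchy_Schwarz scaleC_of_real[symmetric] cinner_scaleC_left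
      scaleR_conv_of_real)

lemma bounded_linear_cinner_right: "bounded_linear (\<lambda>y. cinner (x::'h::complex_hilbert_space) y)"
  by (rule bounded_linear_intro[where K = "norm x"])
    (auto simp: cinner_add_right Cauchy_Schwarz scaleC_of_real[symmetric] cinner_scaleC_right
      scaleR_conv_of_real mult.commute[of _ "norm x"])

lemma bounded_operatorsE:
  assumes "T \<in> bounded_operators"
  obtains K where "clinear_map T" "bounded_linear T" "K > 0" "\<And>x. norm (T x) \<le> K * norm x"
proof -
  obtain K where K: "clinear_map T" "\<And>x. norm (T x) \<le> K * norm x"
    using assms by (auto simp: bounded_operators_def)
  have "norm (T x) \<le> (\<bar>K\<bar> + 1) * norm x" for x
    by (rule order_trans[OF K(2)] mult_right_mono)+ auto
  then show ?thesis
    by (intro that[of "\<bar>K\<bar> + 1"] K clinear_map_imp_bounded_linear[OF K]) auto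
qed

lemma bounded_operators_clinear: "T \<in> bounded_operators \<Longrightarrow> clinear_map T"
  by (simp add: bounded_operators_def)

lemma bounded_operators_bounded_linear: "T \<in> bounded_operators \<Longrightarrow> bounded_linear T"
  by (auto elim: bounded_operatorsE)

lemma bounded_operators_compose:
  assumes "S \<in> bounded_operators" "T \<in> bounded_operators"
  shows "S \<circ> T \<in> bounded_operators"
proof -
  have "bounded_linear (S \<circ> T)"
    unfolding comp_def using assms
    by (intro bounded_linear_compose[of S T] bounded_operators_bounded_linear)
  then obtain K where "\<And>x. norm ((S \<circ> T) x) \<le> norm x * K"
    using bounded_linear.bounded by blast
  then show ?thesis
    using assms by (auto simp: bounded_operators_def clinear_map_def mult.commute[of _ K])
qed

lemma bounded_operators_add:
  assumes "S \<in> bounded_operators" "T \<in> bounded_operators"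
  shows "(\<lambda>x. S x + T x) \<in> bounded_operators"
proof -
  have "bounded_linear (\<lambda>x. S x + T x)"
    using assms by (intro bounded_linear_add bounded_operators_bounded_linear)
  then obtain K where "\<And>x. norm (S x + T x) \<le> norm x * K"
    using bounded_linear.bounded by blast
  then show ?thesis
    using assms by (auto simp: bounded_operators_def clinear_map_def mult.commute[of _ K]
        scaleC_add_right)
qed

lemma bounded_operators_scaleC:
  assumes "T \<in> bounded_operators"
  shows "(\<lambda>x. c *\<^sub>C T x) \<in> bounded_operators"
proof -
  have "bounded_linear (\<lambda>x. c *\<^sub>C T x)"
    using assms by (intro bounded_linear_compose[OF bounded_linear_scaleC]
       bounded_operators_bounded_linear)
  then obtain K where "\<And>x. norm (c *\<^sub>C T x) \<le> norm x * K"
    using bounded_linear.bounded by blast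
  then show ?thesis
    using assms by (auto simp: bounded_operators_def clinear_map_def mult.commute[of _ K]
        scaleC_add_right scaleC_scaleC mult.commute)
qed

section \<open>Diagonal operators form a masa\<close>

text \<open>
  Density of the span, in the form of an induction principle: a property that passes to linear
  combinations and to limits needs checking on basis vectors only.
\<close>

lemma orthonormal_basis_induct:
  assumes "orthonormal_basis B" "csubspace S" "closed S" "B \<subseteq> S"
  shows "x \<in> S"
proof -
  have "csubspace hull B \<subseteq> S" using assms by (simp add: hull_minimal)
  then have "closure (csubspace hull B) \<subseteq> S" using assms by (simp add: closure_minimal)
  then show ?thesis using assms(1) by (auto simp: orthonormal_basis_def)
qed

lemma bounded_operators_eqI:
  assumes "orthonormal_basis B" "S \<in> bounded_operators" "T \<in> bounded_operators"
    and "\<And>e. e \<in> B \<Longrightarrow> S e = T e"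
  shows "S = T"
proof
  fix x
  note S = bounded_operators_clinear[OF assms(2)] and T = bounded_operators_clinear[OF assms(3)]
  have "csubspace {x. S x = T x}"
    by (auto simp: csubspace_def clinear_map_zero[OF S] clinear_map_zero[OF T]
        clinear_map_add[OF S] clinear_map_add[OF T]
        clinear_map_scaleC[OF S] clinear_map_scaleC[OF T])
  moreover have "closed {x. S x = T x}"
    using assms(2,3)
    by (intro closed_Collect_eq linear_continuous_on bounded_operators_bounded_linear)
  ultimately have "x \<in> {x. S x = T x}"
    using assms(4) by (intro orthonormal_basis_induct[OF assms(1)]) auto
  then show "S x = T x" by simp
qed

lemma cinner_basis_eq_0:
  assumes "orthonormal_basis B" "\<And>e. e \<in> B \<Longrightarrow> cinner v e = 0"
  shows "v = 0"
proof -
  have "csubspace {x. cinner v x = 0}"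
    by (auto simp: csubspace_def cinner_add_right cinner_scaleC_right)
  moreover have "closed {x. cinner v x = 0}"
    by (intro closed_Collect_eq linear_continuous_on bounded_linear_cinner_right continuous_on_const)
  ultimately have "v \<in> {x. cinner v x = 0}"
    using assms(2) by (intro orthonormal_basis_induct[OF assms(1)]) auto
  then show ?thesis by (simp add: cinner_self_eq_0)
qed

lemma orthonormal_basis_cinner:
  assumes "orthonormal_basis B" "e \<in> B" "f \<in> B"
  shows "cinner e f = (if e = f then 1 else 0)"
  using assms by (auto simp: orthonormal_basis_def cinner_self)

text \<open>
  The condition on the right concerns matrix coefficients only, hence is closed in the weak
  operator topology.
\<close>

lemma diagonal_operators_iff:
  assumes "orthonormal_basis B" "T \<in> bounded_operators"
  shows "T \<in> diagonal_operators B \<longleftrightarrow> (\<forall>e\<in>B. \<forall>f\<in>B. e \<noteq> f \<longrightarrow> cinner (T e) f = 0)"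
proof
  assume "T \<in> diagonal_operators B"
  then show "\<forall>e\<in>B. \<forall>f\<in>B. e \<noteq> f \<longrightarrow> cinner (T e) f = 0"
    using orthonormal_basis_cinner[OF assms(1)]
    by (auto simp: diagonal_operators_def) (metis cinner_scaleC_left mult_zero_right)
next
  assume *: "\<forall>e\<in>B. \<forall>f\<in>B. e \<noteq> f \<longrightarrow> cinner (T e) f = 0"
  have "T e = cinner (T e) e *\<^sub>C e" if "e \<in> B" for e
  proof -
    have "T e - cinner (T e) e *\<^sub>C e = 0"
      using that * orthonormal_basis_cinner[OF assms(1) that]
      by (intro cinner_basis_eq_0[OF assms(1)])
        (auto simp: cinner_diff_left cinner_scaleC_left)
    then show ?thesis by simp
  qed
  then show "T \<in> diagonal_operators B"
    using assms(2) by (auto simp: diagonal_operators_def)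
qed

text \<open>
  The vectors \<open>y\<close> for which the functional \<open>x \<mapsto> \<langle>T x, y\<rangle>\<close> is of the form \<open>x \<mapsto> \<langle>x, z\<rangle>\<close> form a
  subspace. It is closed, since \<open>z\<close> depends on \<open>y\<close> in a Lipschitz way, and it contains the
  basis, since the eigenvector \<open>e\<close> for the eigenvalue \<open>t\<close> admits \<open>z = cnj t e\<close>.
\<close>

lemma diagonal_operators_adjoint:
  assumes B: "orthonormal_basis B" and T: "T \<in> diagonal_operators B"
  obtains S where "S \<in> diagonal_operators B" "is_adjoint_of S T"
proof -
  have Tb: "T \<in> bounded_operators" using T by (simp add: diagonal_operators_def)
  then obtain K where T': "clinear_map T" "bounded_linear T" and
    K: "K > 0" "\<And>x. norm (T x) \<le> K * norm x" by (auto elim: bounded_operatorsE)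
  define adj where "adj y z \<longleftrightarrow> (\<forall>x. cinner (T x) y = cinner x z)" for y z
  have bound: "norm z \<le> K * norm y" if "adj y z" for y z
  proof -
    have "cinner z z = cinner (T z) y" using that by (simp add: adj_def)
    then have "(norm z)\<^sup>2 = cmod (cinner (T z) y)"
      by (metis cinner_self norm_of_real abs_power2)
    also have "\<dots> \<le> norm (T z) * norm y" by (rule Cauchy_Schwarz)
    also have "\<dots> \<le> K * norm z * norm y" by (intro mult_right_mono K) auto
    finally have "norm z * norm z \<le> norm z * (K * norm y)"
      by (simp add: power2_eq_square mult_ac)
    then show ?thesis using K by (cases "z = 0") auto
  qed
  have add: "adj (y + y') (z + z')" if "adj y z" "adj y' z'" for y z y' z'
    using that by (simp add: adj_def cinner_add_right)
  have scale: "adj (c *\<^sub>C y) (c *\<^sub>C z)" if "adj y z" for y z c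
    using that by (simp add: adj_def cinner_scaleC_right)
  have diff: "adj (y - y') (z - z')" if "adj y z" "adj y' z'" for y z y' z'
    using add[OF that(1) scale[OF that(2), of "-1"]] by (simp add: scaleC_minus_one)
  have unique: "z = z'" if "adj y z" "adj y z'" for y z z'
    using bound[OF diff[OF that]] by simp
  have basis: "\<exists>c. adj e (c *\<^sub>C e)" if e: "e \<in> B" for e
  proof -
    obtain t where t: "T e = t *\<^sub>C e" using T e by (auto simp: diagonal_operators_def)
    let ?S = "{x. cinner (T x) e = t * cinner x e}"
    have "csubspace ?S"
      by (auto simp: csubspace_def clinear_map_zero[OF T'(1)] clinear_map_add[OF T'(1)]
          clinear_map_scaleC[OF T'(1)] cinner_add_left cinner_scaleC_left algebra_simps)
    moreover have "closed ?S"
      by (intro closed_Collect_eq continuous_on_mult continuous_on_const linear_continuous_on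
          bounded_linear_cinner_left bounded_linear_compose[OF bounded_linear_cinner_left T'(2)])
    moreover have "B \<subseteq> ?S"
    proof safe
      fix f assume f: "f \<in> B"
      show "cinner (T f) e = t * cinner f e"
        using orthonormal_basis_cinner[OF B f e] T f e t
          diagonal_operators_iff[OF B Tb]
        by (auto simp: cinner_scaleC_left)
    qed
    ultimately have "x \<in> ?S" for x by (rule orthonormal_basis_induct[OF B])
    then have "adj e (cnj t *\<^sub>C e)" by (simp add: adj_def cinner_scaleC_right)
    then show ?thesis ..
  qed
  let ?Y = "{y. \<exists>z. adj y z}"
  have "csubspace ?Y"
    unfolding csubspace_def
  proof (intro conjI ballI allI)
    show "0 \<in> ?Y" by (auto simp: adj_def intro: exI[of _ 0])
  qed (use add scale in blast)+
  moreover have "closed ?Y"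
    unfolding closed_sequential_limits
  proof (intro allI impI, elim conjE)
    fix y l assume "\<forall>n. y n \<in> ?Y" and lim: "y \<longlonglongrightarrow> l"
    then obtain z where z: "\<And>n. adj (y n) (z n)" by simp metis
    have "Cauchy z"
    proof (rule CauchyI)
      fix r :: real assume "r > 0"
      then obtain N where N: "\<forall>m\<ge>N. \<forall>n\<ge>N. norm (y m - y n) < r / K"
        using LIMSEQ_imp_Cauchy[OF lim] K(1) CauchyD[of y "r / K"] by auto
      have "norm (z m - z n) < r" if "m \<ge> N" "n \<ge> N" for m n
        using bound[OF diff[OF z z], of m n] N that K(1)
        by (smt (verit) mult.commute pos_less_divide_eq)
      then show "\<exists>N. \<forall>m\<ge>N. \<forall>n\<ge>N. norm (z m - z n) < r" by blast
    qed
    then obtain w where w: "z \<longlonglongrightarrow> w" using Cauchy_convergent convergent_def by blast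
    have "cinner (T x) l = cinner x w" for x
      using bounded_linear.tendsto[OF bounded_linear_cinner_right lim, of "T x"]
        bounded_linear.tendsto[OF bounded_linear_cinner_right w, of x] z
      by (auto simp: adj_def intro: LIMSEQ_unique)
    then show "l \<in> ?Y" by (auto simp: adj_def)
  qed
  moreover have "B \<subseteq> ?Y" using basis by auto
  ultimately have "y \<in> ?Y" for y by (rule orthonormal_basis_induct[OF B])
  then obtain S where S: "\<And>y. adj y (S y)" by simp metis
  have "S (x + y) = S x + S y" "S (c *\<^sub>C x) = c *\<^sub>C S x" for x y c
    using unique[OF S add[OF S S]] unique[OF S scale[OF S]] by auto
  then have "S \<in> bounded_operators"
    using bound[OF S] by (auto simp: bounded_operators_def clinear_map_def)
  moreover have "\<exists>c. S e = c *\<^sub>C e" if "e \<in> B" for e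
    using basis[OF that] unique[OF S] by blast
  ultimately have "S \<in> diagonal_operators B" by (simp add: diagonal_operators_def)
  moreover have "is_adjoint_of S T" using S by (auto simp: is_adjoint_of_def adj_def)
  ultimately show ?thesis by (rule that)
qed

lemma diagonal_operators_commute:
  assumes "orthonormal_basis B" "S \<in> diagonal_operators B" "T \<in> diagonal_operators B"
  shows "S \<circ> T = T \<circ> S"
proof (rule bounded_operators_eqI[OF assms(1)])
  have *: "S \<in> bounded_operators" "T \<in> bounded_operators"
    using assms by (auto simp: diagonal_operators_def)
  then show "S \<circ> T \<in> bounded_operators" "T \<circ> S \<in> bounded_operators"
    by (auto intro: bounded_operators_compose)
  fix e assume "e \<in> B"
  then obtain s t where "S e = s *\<^sub>C e" "T e = t *\<^sub>C e"
    using assms unfolding diagonal_operators_def by blast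
  then show "(S \<circ> T) e = (T \<circ> S) e"
    using * by (simp add: clinear_map_scaleC bounded_operators_clinear scaleC_scaleC mult.commute)
qed

lemma rank_one_projection_diagonal:
  assumes "orthonormal_basis B" "e \<in> B"
  shows "(\<lambda>x. cinner x e *\<^sub>C e) \<in> diagonal_operators B"
proof -
  have e: "norm e = 1" using assms by (auto simp: orthonormal_basis_def)
  have "norm (cinner x e *\<^sub>C e) \<le> 1 * norm x" for x
    using Cauchy_Schwarz[of x e] e by (simp add: norm_scaleC)
  then have "(\<lambda>x. cinner x e *\<^sub>C e) \<in> bounded_operators"
    unfolding bounded_operators_def clinear_map_def
    by (auto simp: cinner_add_left cinner_scaleC_left scaleC_add_left scaleC_scaleC
      intro!: exI[of _ 1])
  then show ?thesis
    using assms by (auto simp: diagonal_operators_iff orthonormal_basis_cinner cinner_scaleC_left)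
qed

text \<open>
  An operator that commutes with the projection onto the line of each basis vector maps each of
  these lines into itself; this is why nothing can be added to the diagonal operators.
\<close>

lemma masa_diagonal_operators:
  assumes B: "orthonormal_basis B"
  shows "masa (diagonal_operators B)"
proof -
  let ?D = "diagonal_operators B"
  have bo: "?D \<subseteq> bounded_operators" by (auto simp: diagonal_operators_def)
  have "selfadjoint_operator_algebra ?D"
    unfolding selfadjoint_operator_algebra_def
  proof (intro conjI ballI allI bo)
    show "(\<lambda>x. 0) \<in> ?D"
      by (auto simp: diagonal_operators_def bounded_operators_def clinear_map_def
          intro!: exI[of _ 0])
    fix T assume T: "T \<in> ?D"
    show "\<exists>S\<in>?D. is_adjoint_of S T"
      using diagonal_operators_adjoint[OF B T] by blast
    show "(\<lambda>x. c *\<^sub>C T x) \<in> ?D" for c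
      using T bo by (auto simp: diagonal_operators_iff[OF B] bounded_operators_scaleC
          cinner_scaleC_left)
    fix S assume S: "S \<in> ?D"
    show "(\<lambda>x. S x + T x) \<in> ?D"
    proof -
      have "S \<in> bounded_operators" "T \<in> bounded_operators" using S T bo by auto
      then show ?thesis
        using S T by (simp add: diagonal_operators_iff[OF B] bounded_operators_add cinner_add_left)
    qed
    have "\<exists>c. (S \<circ> T) e = c *\<^sub>C e" if "e \<in> B" for e
    proof -
      obtain s t where "S e = s *\<^sub>C e" "T e = t *\<^sub>C e"
        using S T \<open>e \<in> B\<close> unfolding diagonal_operators_def by blast
      then show ?thesis
        using S bo by (auto simp: clinear_map_scaleC bounded_operators_clinear scaleC_scaleC subset_eq)
    qed
    then show "S \<circ> T \<in> ?D"
      using S T bo by (auto simp: diagonal_operators_def bounded_operators_compose)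
  qed
  moreover have "commuting_operators ?D"
    using diagonal_operators_commute[OF B] by (auto simp: commuting_operators_def)
  moreover have "F = ?D"
    if F: "selfadjoint_operator_algebra F" "commuting_operators F" "?D \<subseteq> F" for F
  proof (intro antisym F(3) subsetI)
    fix T assume T: "T \<in> F"
    have Tb: "T \<in> bounded_operators"
      using F(1) T by (auto simp: selfadjoint_operator_algebra_def)
    have "T e = cinner (T e) e *\<^sub>C e" if e: "e \<in> B" for e
    proof -
      let ?P = "\<lambda>x. cinner x e *\<^sub>C e"
      have "?P \<in> F" using rank_one_projection_diagonal[OF B e] F(3) by blast
      then have "(T \<circ> ?P) e = (?P \<circ> T) e"
        using F(2) T unfolding commuting_operators_def by metis
      then show ?thesis using orthonormal_basis_cinner[OF B e e] by simp
    qed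
    then show "T \<in> ?D" using Tb by (auto simp: diagonal_operators_def)
  qed
  ultimately show ?thesis by (auto simp: masa_def)
qed

text \<open>
  Operators with a common bound are controlled at any given vector \<open>x\<close>, up to \<open>\<epsilon>\<close>, by their
  values on finitely many basis vectors. The set \<open>F\<close> is chosen before \<open>S\<close>, so it serves all \<open>S\<close>
  at once.
\<close>

lemma bounded_operators_close_if_agree_on_finite:
  assumes basis: "orthonormal_basis B" and T: "T \<in> bounded_operators"
    and K: "K > 0" "\<And>x. norm (T x) \<le> K * norm x"
    and \<epsilon>: "\<epsilon> > 0"
  shows "\<exists>F. finite F \<and> F \<subseteq> B \<and> (\<forall>S \<in> bounded_operators.
    (\<forall>f\<in>F. S f = T f) \<and> (\<forall>v. norm (S v) \<le> K * norm v) \<longrightarrow> norm (S x - T x) < \<epsilon>)"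
proof -
  have lin: "clinear_map T" using T by (rule bounded_operators_clinear)
  define admissible where "admissible F = {S \<in> bounded_operators.
    (\<forall>f\<in>F. S f = T f) \<and> (\<forall>v. norm (S v) \<le> K * norm v)}" for F
  have anti: "admissible (F \<union> G) \<subseteq> admissible F" "admissible (F \<union> G) \<subseteq> admissible G" for F G
    by (auto simp: admissible_def)
  have admlin: "clinear_map S" if "S \<in> admissible F" for S F
    using that by (simp add: admissible_def bounded_operators_clinear)
  define Q where "Q x \<epsilon> F \<longleftrightarrow> finite F \<and> F \<subseteq> B \<and> (\<forall>S \<in> admissible F. norm (S x - T x) < \<epsilon>)" for x \<epsilon> F
  let ?X = "{x. \<forall>\<epsilon>>0. \<exists>F. Q x \<epsilon> F}"
  have "csubspace ?X"
    unfolding csubspace_def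
  proof (intro conjI ballI allI)
    show "0 \<in> ?X"
      by (auto simp: Q_def clinear_map_zero[OF lin] clinear_map_zero[OF admlin]
        intro!: exI[of _ "{}"])
  next
    fix x y assume x: "x \<in> ?X" and y: "y \<in> ?X"
    show "x + y \<in> ?X"
    proof (intro CollectI allI impI)
      fix \<epsilon> :: real assume "\<epsilon> > 0"
      then obtain F G where F: "Q x (\<epsilon> / 2) F" and G: "Q y (\<epsilon> / 2) G"
        using x y half_gt_zero[of \<epsilon>] by blast
      have "norm (S (x + y) - T (x + y)) < \<epsilon>" if S: "S \<in> admissible (F \<union> G)" for S
      proof -
        have "norm (S x - T x) < \<epsilon> / 2" "norm (S y - T y) < \<epsilon> / 2"
          using F G S anti unfolding Q_def by blast+
        then have "norm ((S x - T x) + (S y - T y)) < \<epsilon> / 2 + \<epsilon> / 2"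
          by (rule norm_add_less)
        then show ?thesis by (simp add: clinear_map_add[OF lin] clinear_map_add[OF admlin[OF S]]
              algebra_simps)
      qed
      then show "\<exists>F. Q (x + y) \<epsilon> F"
        using F G by (intro exI[of _ "F \<union> G"]) (auto simp: Q_def)
    qed
  next
    fix c x assume x: "x \<in> ?X"
    show "c *\<^sub>C x \<in> ?X"
    proof (intro CollectI allI impI)
      fix \<epsilon> :: real assume "\<epsilon> > 0"
      then have "\<epsilon> / (cmod c + 1) > 0" by (simp add: add_nonneg_pos)
      then obtain F where F: "Q x (\<epsilon> / (cmod c + 1)) F" using x by blast
      have "norm (S (c *\<^sub>C x) - T (c *\<^sub>C x)) < \<epsilon>" if S: "S \<in> admissible F" for S
      proof -
        have "norm (S x - T x) < \<epsilon> / (cmod c + 1)" using F S unfolding Q_def by blast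
        then have "(cmod c + 1) * norm (S x - T x) < \<epsilon>"
          by (simp add: pos_less_divide_eq add_nonneg_pos mult.commute)
        then have "norm (c *\<^sub>C (S x - T x)) < \<epsilon>"
          unfolding norm_scaleC distrib_right using norm_ge_zero[of "S x - T x"] by linarith
        then show ?thesis
          by (simp add: clinear_map_scaleC[OF lin] clinear_map_scaleC[OF admlin[OF S]]
            scaleC_diff_right)
      qed
      then show "\<exists>F. Q (c *\<^sub>C x) \<epsilon> F" using F by (auto simp: Q_def)
    qed
  qed
  moreover have "closed ?X"
    unfolding closure_subset_eq[symmetric]
  \<comment> \<open>\<open>S\<close> and \<open>T\<close> move \<open>x - y\<close> by less than \<open>\<epsilon>/4\<close> each.\<close>
  proof (intro subsetI allI impI CollectI)
    fix x and \<epsilon> :: real assume "x \<in> closure ?X" and \<epsilon>: "\<epsilon> > 0"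
    then have x: "\<forall>e>0. \<exists>y\<in>?X. dist y x < e" by (simp only: closure_approachable)
    have "\<epsilon> / (4 * K) > 0" using K(1) \<epsilon> by simp
    then obtain y where y: "y \<in> ?X" "dist y x < \<epsilon> / (4 * K)" using x by blast
    then obtain F where F: "Q y (\<epsilon> / 2) F" using half_gt_zero[OF \<epsilon>] by blast
    have yx: "K * norm (x - y) < \<epsilon> / 4"
      using y(2) K(1) by (simp add: dist_norm norm_minus_commute field_simps)
    have "norm (S x - T x) < \<epsilon>" if S: "S \<in> admissible F" for S
    proof -
      have "norm (S y - T y) < \<epsilon> / 2" using F S unfolding Q_def by blast
      moreover have "norm (S (x - y)) \<le> K * norm (x - y)" using S by (simp add: admissible_def)
      moreover note K(2)[of "x - y"] yx
      moreover have "(S y - T y) + (S (x - y) - T (x - y)) = S x - T x"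
        by (simp add: clinear_map_diff[OF lin] clinear_map_diff[OF admlin[OF S]])
      then have "norm (S x - T x) \<le> norm (S y - T y) + (norm (S (x - y)) + norm (T (x - y)))"
        using norm_triangle_ineq[of "S y - T y" "S (x - y) - T (x - y)"]
          norm_triangle_ineq4[of "S (x - y)" "T (x - y)"] by (metis add_left_mono order_trans)
      ultimately show ?thesis by linarith
    qed
    then show "\<exists>F. Q x \<epsilon> F" using F by (auto simp: Q_def)
  qed
  moreover have "B \<subseteq> ?X"
  proof (intro subsetI CollectI allI impI)
    fix e and \<epsilon> :: real assume "e \<in> B" "\<epsilon> > 0"
    then show "\<exists>F. Q e \<epsilon> F" by (intro exI[of _ "{e}"]) (auto simp: Q_def admissible_def)
  qed
  ultimately have "x \<in> ?X" by (rule orthonormal_basis_induct[OF basis])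
  then obtain F where "Q x \<epsilon> F" using \<epsilon> by blast
  then show ?thesis by (intro exI[of _ F]) (simp add: Q_def admissible_def)
qed

section \<open>Representations of a unital C*-algebra are contractive\<close>

lemma star_zero [simp]: "star (0::'a::unital_cstar_algebra) = 0"
  using star_add[of "0::'a" 0] by simp

lemma star_one [simp]: "star (1::'a::unital_cstar_algebra) = 1"
proof -
  have "star (1::'a) = star 1 * star (star 1)" by (simp add: star_star)
  also have "\<dots> = star (star 1 * 1)" by (simp only: star_mult)
  finally show ?thesis by (simp add: star_star)
qed

lemma star_minus: "star (- x) = - star (x::'a::unital_cstar_algebra)"
  using star_scaleC[of "-1" x] by (simp add: scaleC_minus_one)

lemma star_diff: "star (x - y) = star x - star (y::'a::unital_cstar_algebra)"
  using star_add[of x "- y"] by (simp add: star_minus)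

lemma star_scaleR: "star (r *\<^sub>R x) = r *\<^sub>R star (x::'a::unital_cstar_algebra)"
  using star_scaleC[of "complex_of_real r" x] by (simp add: scaleC_of_real)

lemma star_power: "star (x ^ n) = star (x::'a::unital_cstar_algebra) ^ n"
  by (induction n) (auto simp: star_mult power_commutes)

lemma norm_star: "norm (star x) = norm (x::'a::unital_cstar_algebra)"
proof -
  have "norm y \<le> norm (star y)" for y :: 'a
  proof -
    have "norm y * norm y \<le> norm (star y) * norm y"
      using cstar_identity[of y] norm_mult_ineq[of "star y" y] by (simp add: power2_eq_square)
    then show ?thesis by (cases "y = 0") auto
  qed
  from this[of x] this[of "star x"] show ?thesis by (simp add: star_star)
qed

lemma bounded_linear_star: "bounded_linear (star :: 'a::unital_cstar_algebra \<Rightarrow> 'a)"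
  by (rule bounded_linear_intro[where K = 1]) (auto simp: star_add star_scaleR norm_star)

lemma cstar_subalgebraD:
  assumes "cstar_subalgebra M"
  shows "x \<in> M \<Longrightarrow> y \<in> M \<Longrightarrow> x + y \<in> M" "x \<in> M \<Longrightarrow> y \<in> M \<Longrightarrow> x - y \<in> M"
    "x \<in> M \<Longrightarrow> c *\<^sub>C x \<in> M" "x \<in> M \<Longrightarrow> y \<in> M \<Longrightarrow> x * y \<in> M" "x \<in> M \<Longrightarrow> star x \<in> M"
  using assms csubspaceD[of M] by (auto simp: cstar_subalgebra_def)

lemma abs_gbinomial_half_le_1: "\<bar>(1/2::real) gchoose k\<bar> \<le> 1"
proof (induction k)
  case (Suc k)
  have eq: "real (Suc k) * ((1/2) gchoose Suc k) = (1/2 - real k) * ((1/2) gchoose k)"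
    using gbinomial_absorb_comp[of "1/2::real" k] gbinomial_absorption[of k "1/2::real"] by simp
  have "real (Suc k) * \<bar>(1/2) gchoose Suc k\<bar> = \<bar>1/2 - real k\<bar> * \<bar>(1/2::real) gchoose k\<bar>"
    using arg_cong[OF eq, of abs] by (simp only: abs_mult abs_of_nat)
  also have "\<dots> \<le> real (Suc k) * 1"
    by (intro mult_mono Suc) auto
  finally show ?case by (simp del: of_nat_Suc)
qed simp

text \<open>
  The root is the binomial series of \<open>(1 - c)\<^bsup>1/2\<^esup>\<close>, dominated by a geometric series. By
  Vandermonde's identity its Cauchy square has the coefficients of \<open>(1 - c)\<^bsup>1\<^esup>\<close>.
\<close>

lemma selfadjoint_sqrt_one_minus:
  fixes c :: "'a::unital_cstar_algebra"
  assumes "star c = c" "norm c < 1"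
  obtains b where "star b = b" "b * b = 1 - c"
proof -
  define a where "a k = ((1/2::real) gchoose k) *\<^sub>R (- c) ^ k" for k
  have "norm (a k) \<le> norm c ^ k" for k
  proof -
    have "norm (a k) = \<bar>(1/2::real) gchoose k\<bar> * norm ((- c) ^ k)" by (simp add: a_def)
    also have "\<dots> \<le> 1 * norm (- c) ^ k"
      by (intro mult_mono abs_gbinomial_half_le_1 norm_power_ineq) auto
    finally show ?thesis by simp
  qed
  moreover have "summable (\<lambda>k. norm c ^ k)" using assms(2) by (simp add: summable_geometric)
  ultimately have sn: "summable (\<lambda>k. norm (a k))"
    by (intro summable_comparison_test[of "\<lambda>k. norm (a k)" "\<lambda>k. norm c ^ k"]) auto
  define b where "b = suminf a"
  have b: "a sums b" unfolding b_def using summable_norm_cancel[OF sn] by (rule summable_sums)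
  have "(\<lambda>k. star (a k)) sums star b"
    using bounded_linear.sums[OF bounded_linear_star b] .
  moreover have "star (a k) = a k" for k
    by (simp add: a_def star_scaleR star_power star_minus assms)
  ultimately have "star b = b" using b sums_unique2 by simp
  moreover have "b * b = 1 - c"
  proof -
    have "(\<lambda>k. \<Sum>i\<le>k. a i * a (k - i)) sums (b * b)"
      unfolding b_def by (intro Cauchy_product_sums sn)
    moreover have "(\<Sum>i\<le>k. a i * a (k - i)) = ((1::real) gchoose k) *\<^sub>R (- c) ^ k" for k
    proof -
      have "(\<Sum>i\<le>k. a i * a (k - i))
          = (\<Sum>i\<le>k. (((1/2) gchoose i) * ((1/2) gchoose (k - i))) *\<^sub>R (- c) ^ k)"
        by (intro sum.cong refl) (simp add: a_def flip: power_add)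
      also have "\<dots> = (1/2 + 1/2 gchoose k) *\<^sub>R (- c) ^ k"
        unfolding gbinomial_Vandermonde[symmetric] scaleR_sum_left atLeast0AtMost ..
      finally show ?thesis by simp
    qed
    ultimately have "(\<lambda>k. ((1::real) gchoose k) *\<^sub>R (- c) ^ k) sums (b * b)" by simp
    moreover have "(\<lambda>k. ((1::real) gchoose k) *\<^sub>R (- c) ^ k)
        sums (\<Sum>k\<in>{0,1}. ((1::real) gchoose k) *\<^sub>R (- c) ^ k)"
    proof (rule sums_finite)
      fix k :: nat assume "k \<notin> {0, 1}"
      then have "1 < k" by auto
      then have "(1::real) gchoose k = 0"
        using binomial_gbinomial[of 1 k, where 'a = real] by (simp add: binomial_eq_0)
      then show "((1::real) gchoose k) *\<^sub>R (- c) ^ k = 0" by simp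
    qed simp
    ultimately show ?thesis using sums_unique2 by fastforce
  qed
  ultimately show ?thesis by (rule that)
qed

lemma star_representationD:
  assumes "star_representation \<pi>"
  shows "\<pi> a \<in> bounded_operators" "clinear_map (\<pi> a)" "bounded_linear (\<pi> a)"
    "\<pi> 1 v = v" "\<pi> (a + b) v = \<pi> a v + \<pi> b v" "\<pi> (c *\<^sub>C a) v = c *\<^sub>C \<pi> a v"
    "\<pi> (a * b) v = \<pi> a (\<pi> b v)" "cinner (\<pi> a v) w = cinner v (\<pi> (star a) w)"
    "\<pi> (a - b) v = \<pi> a v - \<pi> b v"
proof -
  show "\<pi> a \<in> bounded_operators" "\<pi> 1 v = v"
    "\<pi> (a * b) v = \<pi> a (\<pi> b v)" "cinner (\<pi> a v) w = cinner v (\<pi> (star a) w)"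
    using assms by (auto simp: star_representation_def is_adjoint_of_def)
  then show "clinear_map (\<pi> a)" "bounded_linear (\<pi> a)"
    by (auto intro: bounded_operators_clinear bounded_operators_bounded_linear)
  show add: "\<pi> (a + b) v = \<pi> a v + \<pi> b v"
    and scale: "\<pi> (c *\<^sub>C a) v = c *\<^sub>C \<pi> a v" for a b c v
    using assms by (auto simp: star_representation_def)
  show "\<pi> (a - b) v = \<pi> a v - \<pi> b v"
    using add[of a "(-1) *\<^sub>C b" v] unfolding scale by (simp add: scaleC_minus_one)
qed

lemma cinner_representation:
  assumes "star_representation \<pi>"
  shows "cinner (\<pi> a v) (\<pi> b w) = cinner (\<pi> (star b * a) v) w"
  using star_representationD(7,8)[OF assms] by (metis star_star)

text \<open>
  For \<open>r > \<parallel>a\<parallel>\<^sup>2\<close> the element \<open>1 - a\<^sup>* a / r\<close> is a square \<open>b\<^sup>* b\<close>, and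
  \<open>0 \<le> \<parallel>\<pi>(b) v\<parallel>\<^sup>2 = \<parallel>v\<parallel>\<^sup>2 - \<parallel>\<pi>(a) v\<parallel>\<^sup>2 / r\<close>.
\<close>

lemma star_representation_contractive:
  assumes \<pi>: "star_representation \<pi>"
  shows "norm (\<pi> a v) \<le> norm a * norm v"
proof -
  note repD = star_representationD[OF \<pi>]
  have *: "(norm (\<pi> a v))\<^sup>2 \<le> r * (norm v)\<^sup>2" if r: "r > (norm a)\<^sup>2" for r
  proof -
    have r0: "r > 0" using r zero_le_power2[of "norm a"] by linarith
    define c where "c = inverse r *\<^sub>R (star a * a)"
    have "star c = c" by (simp add: c_def star_scaleR star_mult star_star)
    moreover have "norm c < 1"
      using r r0 by (simp add: c_def cstar_identity divide_simps)
    ultimately obtain b where b: "star b = b" "b * b = 1 - c"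
      by (rule selfadjoint_sqrt_one_minus)
    have "complex_of_real ((norm (\<pi> b v))\<^sup>2) = cinner (\<pi> (star b * b) v) v"
      by (metis cinner_self cinner_representation[OF \<pi>])
    also have "\<dots> = cinner v v - cinner (\<pi> c v) v"
      by (simp add: b repD cinner_diff_left)
    also have "\<pi> c v = complex_of_real (inverse r) *\<^sub>C \<pi> (star a * a) v"
      unfolding c_def scaleC_of_real[symmetric] repD(6) ..
    also have "cinner v v - cinner \<dots> v = complex_of_real ((norm v)\<^sup>2 - inverse r * (norm (\<pi> a v))\<^sup>2)"
      by (simp add: cinner_scaleC_left cinner_representation[OF \<pi>, symmetric] cinner_self)
    finally have "(norm (\<pi> b v))\<^sup>2 = (norm v)\<^sup>2 - inverse r * (norm (\<pi> a v))\<^sup>2"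
      unfolding of_real_eq_iff .
    then have "inverse r * (norm (\<pi> a v))\<^sup>2 \<le> (norm v)\<^sup>2"
      using zero_le_power2[of "norm (\<pi> b v)"] by linarith
    then show ?thesis using r0 by (simp add: field_simps)
  qed
  have "(norm (\<pi> a v))\<^sup>2 \<le> (norm a)\<^sup>2 * (norm v)\<^sup>2"
  proof (cases "v = 0")
    case True
    then show ?thesis using repD(2) by (simp add: clinear_map_zero)
  next
    case False
    show ?thesis
    proof (rule ccontr)
      assume "\<not> ?thesis"
      then have "(norm a)\<^sup>2 < (norm (\<pi> a v))\<^sup>2 / (norm v)\<^sup>2"
        using False by (simp add: field_simps)
      then obtain r where "(norm a)\<^sup>2 < r" "r < (norm (\<pi> a v))\<^sup>2 / (norm v)\<^sup>2"
        using dense by blast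
      then show False using *[of r] False by (simp add: field_simps)
    qed
  qed
  then have "(norm (\<pi> a v))\<^sup>2 \<le> (norm a * norm v)\<^sup>2" by (simp add: power_mult_distrib)
  then show ?thesis by (rule power2_le_imp_le) simp
qed

lemma bounded_linear_representation:
  assumes "star_representation \<pi>"
  shows "bounded_linear (\<lambda>a. \<pi> a v)"
  using star_representationD(5,6)[OF assms] star_representation_contractive[OF assms]
  by (intro clinear_map_imp_bounded_linear[where K = "norm v"])
    (auto simp: clinear_map_def mult.commute)

section \<open>Commutants and generated C*-algebras\<close>

definition commutant :: "'a::unital_cstar_algebra set \<Rightarrow> 'a set" where
  "commutant S = {b. \<forall>s\<in>S. b * s = s * b}"

lemma cstar_subalgebra_commutant:
  fixes S :: "'a::unital_cstar_algebra set"
  assumes "\<And>s. s \<in> S \<Longrightarrow> star s \<in> S"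
  shows "cstar_subalgebra (commutant S)"
  unfolding cstar_subalgebra_def
proof (intro conjI ballI)
  show "csubspace (commutant S)"
    by (auto simp: csubspace_def commutant_def distrib_left distrib_right
        scaleC_mult_left scaleC_mult_right)
  have "commutant S = (\<Inter>s\<in>S. {b. b * s = s * b})" by (auto simp: commutant_def)
  moreover have "closed \<dots>"
    by (intro closed_INT ballI closed_Collect_eq continuous_intros)
  ultimately show "closed (commutant S)" by simp
  fix x assume x: "x \<in> commutant S"
  show "star x \<in> commutant S"
    unfolding commutant_def
  proof safe
    fix s assume "s \<in> S"
    then have "x * star s = star s * x" using x assms by (auto simp: commutant_def)
    then have "star (x * star s) = star (star s * x)" by simp
    then show "star x * s = s * star x" by (simp add: star_mult star_star)
  qed
  fix y assume y: "y \<in> commutant S"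
  show "x * y \<in> commutant S"
    unfolding commutant_def
  proof safe
    fix s assume "s \<in> S"
    then have "x * s = s * x" "y * s = s * y" using x y by (auto simp: commutant_def)
    then show "x * y * s = s * (x * y)" by (metis mult.assoc)
  qed
qed

text \<open>
  If a selfadjoint \<open>a\<close> commutes with \<open>M\<close>, then the double commutant of \<open>M\<close> and \<open>a\<close> is an abelian
  C*-algebra, so it is \<open>M\<close> by maximality. The general case follows by taking real and imaginary
  parts.
\<close>

lemma commutant_maximal_abelian_subset:
  fixes M :: "'a::unital_cstar_algebra set"
  assumes M: "maximal_abelian_cstar_subalgebra M"
  shows "commutant M \<subseteq> M"
proof
  have Mab: "\<And>x y. x \<in> M \<Longrightarrow> y \<in> M \<Longrightarrow> x * y = y * x"
    and Mstar: "\<And>x. x \<in> M \<Longrightarrow> star x \<in> M" and Msub: "csubspace M"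
    and max: "\<And>B. cstar_subalgebra B \<Longrightarrow> abelian B \<Longrightarrow> M \<subseteq> B \<Longrightarrow> B = M"
    using M by (auto simp: maximal_abelian_cstar_subalgebra_def cstar_subalgebra_def abelian_def)
  have sa: "a \<in> M" if a: "a \<in> commutant M" "star a = a" for a
  proof -
    let ?S = "insert a M"
    have S: "\<And>s. s \<in> ?S \<Longrightarrow> star s \<in> ?S" using Mstar a by auto
    have S': "?S \<subseteq> commutant ?S"
      using a(1) Mab by (auto simp: commutant_def)
    have S'': "?S \<subseteq> commutant (commutant ?S)" by (auto simp: commutant_def)
    have "cstar_subalgebra (commutant ?S)" using S by (rule cstar_subalgebra_commutant)
    then have "cstar_subalgebra (commutant (commutant ?S))"
      by (intro cstar_subalgebra_commutant) (auto simp: cstar_subalgebra_def)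
    moreover have "abelian (commutant (commutant ?S))"
      using S' unfolding abelian_def commutant_def by blast
    ultimately have "commutant (commutant ?S) = M"
      using S'' by (intro max) auto
    then show ?thesis using S'' by auto
  qed
  fix a assume a: "a \<in> commutant M"
  have "cstar_subalgebra (commutant M)" using Mstar by (rule cstar_subalgebra_commutant)
  then have c: "csubspace (commutant M)" "star a \<in> commutant M"
    using a by (auto simp: cstar_subalgebra_def)
  let ?h = "a + star a" and ?k = "\<i> *\<^sub>C (a - star a)"
  have "?h \<in> M"
    by (rule sa) (auto intro: csubspaceD[OF c(1)] a c(2) simp: star_add star_star)
  moreover have "?k \<in> M"
  proof (rule sa)
    show "?k \<in> commutant M" by (intro csubspaceD[OF c(1)] a c(2))
    have "star ?k = (- \<i>) *\<^sub>C (star a - a)" by (simp add: star_scaleC star_diff star_star)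
    also have "\<dots> = \<i> *\<^sub>C ((-1) *\<^sub>C (star a - a))" by (simp only: scaleC_scaleC) simp
    also have "\<dots> = ?k" by (simp add: scaleC_minus_one)
    finally show "star ?k = ?k" .
  qed
  ultimately have "(1/2) *\<^sub>C ?h + (- \<i>/2) *\<^sub>C ?k \<in> M"
    by (meson csubspaceD(2,3)[OF Msub])
  also have "(1/2) *\<^sub>C ?h + (- \<i>/2) *\<^sub>C ?k = (1/2) *\<^sub>C (?h + (a - star a))"
  proof -
    have "(- \<i>/2) *\<^sub>C ?k = (1/2) *\<^sub>C (a - star a)" by (simp add: scaleC_scaleC)
    then show ?thesis by (simp only: scaleC_add_right)
  qed
  also have "?h + (a - star a) = 2 *\<^sub>C a"
    using scaleC_add_left[of 1 1 a] by simp
  also have "(1/2) *\<^sub>C 2 *\<^sub>C a = a" by (simp add: scaleC_scaleC)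
  finally show "a \<in> M" .
qed

text \<open>
  The closed linear span of a set closed under adjoints and, up to 0, products is a C*-algebra:
  for a fixed factor, the set of \<open>y\<close> with \<open>x * y\<close> in the span is again a closed subspace, so
  products can be checked on \<open>N\<close> in one factor after the other.
\<close>

lemma closed_span_star_semigroup:
  fixes N :: "'a::unital_cstar_algebra set"
  assumes mult: "\<And>x y. x \<in> N \<Longrightarrow> y \<in> N \<Longrightarrow> x * y \<in> insert 0 N"
    and star: "\<And>x. x \<in> N \<Longrightarrow> star x \<in> N"
    and S: "csubspace S" "closed S" "N \<subseteq> S"
  shows "cstar_subalgebra hull N \<subseteq> S"
proof -
  let ?P = "\<lambda>S. csubspace S \<and> closed S"
  let ?C = "?P hull N"
  have C: "csubspace ?C" "closed ?C"
    using hull_in[of ?P N] by (auto simp: csubspace_def intro: closed_Inter)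
  note CD = csubspaceD[OF C(1)]
  have N: "x \<in> ?C" if "x \<in> N" for x using that hull_subset[of N ?P] by blast
  have ind: "?C \<subseteq> f -` ?C" if f: "clinear_map f" "continuous_on UNIV f" "N \<subseteq> f -` ?C" for f
  proof (rule hull_minimal[OF f(3)])
    show "?P (f -` ?C)"
      using f CD closed_vimage[OF C(2) f(2)]
      by (auto simp: csubspace_def clinear_map_zero clinear_map_add clinear_map_scaleC)
  qed
  have "x * y \<in> ?C" if x: "x \<in> ?C" and y: "y \<in> ?C" for x y
  proof -
    have *: "n * y \<in> ?C" if n: "n \<in> N" for n
    proof -
      have "?C \<subseteq> (\<lambda>y. n * y) -` ?C"
        using mult[OF n] N CD(1)
        by (intro ind continuous_intros)
          (auto simp: clinear_map_def distrib_left scaleC_mult_right)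
      then show ?thesis using y by auto
    qed
    have "?C \<subseteq> (\<lambda>x. x * y) -` ?C"
      using * by (intro ind continuous_intros)
        (auto simp: clinear_map_def distrib_right scaleC_mult_left)
    then show ?thesis using x by auto
  qed
  moreover have "star x \<in> ?C" if x: "x \<in> ?C" for x
  proof -
    \<comment> \<open>\<open>star\<close> is conjugate linear, so its case is settled by a separate induction over the hull.\<close>
    have "?C \<subseteq> star -` ?C"
    proof (rule hull_minimal)
      show "N \<subseteq> star -` ?C" using star N by auto
      show "?P (star -` ?C)"
        using CD closed_vimage[OF C(2) linear_continuous_on[OF bounded_linear_star]]
        by (auto simp: csubspace_def star_add star_scaleC)
    qed
    then show ?thesis using x by auto
  qed
  ultimately have "cstar_subalgebra ?C" using C by (auto simp: cstar_subalgebra_def)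
  then have "cstar_subalgebra hull N \<subseteq> ?C" by (intro hull_minimal hull_subset)
  also have "?C \<subseteq> S" using S by (intro hull_minimal) auto
  finally show ?thesis .
qed

lemma normalizers_mult:
  assumes "n \<in> normalizers M" "m \<in> normalizers M"
  shows "n * m \<in> insert 0 (normalizers M)"
proof -
  have "star (n * m) * h * (n * m) \<in> M" "n * m * h * star (n * m) \<in> M" if "h \<in> M" for h
  proof -
    have "star (n * m) * h * (n * m) = star m * (star n * h * n) * m"
      "n * m * h * star (n * m) = n * (m * h * star m) * star n"
      by (simp_all add: star_mult mult.assoc)
    then show "star (n * m) * h * (n * m) \<in> M" "n * m * h * star (n * m) \<in> M"
      using assms that by (auto simp: normalizers_def)
  qed
  then show ?thesis by (auto simp: normalizers_def)
qed

text \<open>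
  Regularity asks for the generated C*-algebra; since the normalizers together with 0 are closed under
  products and adjoints, linear combinations and limits suffice.
\<close>

lemma regular_closed_csubspace:
  assumes "regular_subalgebra M" "csubspace S" "closed S" "normalizers M \<subseteq> S"
  shows "a \<in> S"
  using closed_span_star_semigroup[OF normalizers_mult star_normalizer assms(2-4)] assms(1)
  by (auto simp: regular_subalgebra_def)

section \<open>Unitaries with prescribed eigenvalues\<close>

lemma star_exp: "star (exp x) = exp (star (x::'a::unital_cstar_algebra))"
proof -
  have "(\<lambda>n. star (x ^ n /\<^sub>R fact n)) sums star (exp x)"
    by (intro bounded_linear.sums[OF bounded_linear_star] exp_converges)
  then have "(\<lambda>n. star x ^ n /\<^sub>R fact n) sums star (exp x)"
    by (simp add: star_scaleR star_power)
  then show ?thesis using exp_converges sums_unique2 by blast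
qed

lemma star_exp_ii_mult_self:
  assumes "star a = (a::'a::unital_cstar_algebra)"
  shows "star (exp (\<i> *\<^sub>C a)) * exp (\<i> *\<^sub>C a) = 1"
proof -
  have "star (\<i> *\<^sub>C a) = - (\<i> *\<^sub>C a)"
  proof -
    have "star (\<i> *\<^sub>C a) = (-1 * \<i>) *\<^sub>C a" by (simp add: star_scaleC assms)
    also have "\<dots> = (-1) *\<^sub>C (\<i> *\<^sub>C a)" by (simp only: scaleC_scaleC)
    finally show ?thesis by (simp only: scaleC_minus_one)
  qed
  then show ?thesis using exp_minus_inverse[of "- (\<i> *\<^sub>C a)"] by (simp add: star_exp)
qed

lemma exp_in_cstar_subalgebra:
  assumes "cstar_subalgebra M" "1 \<in> M" "x \<in> M"
  shows "exp x \<in> M"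
proof (rule closed_csubspace_sums)
  show M: "csubspace M" "closed M" using assms by (auto simp: cstar_subalgebra_def)
  have "x ^ n \<in> M" for n
    using assms by (induction n) (auto simp: cstar_subalgebra_def)
  then show "x ^ n /\<^sub>R fact n \<in> M" for n by (rule csubspaceD(5)[OF M(1)])
  show "(\<lambda>n. x ^ n /\<^sub>R fact n) sums exp x" by (rule exp_converges)
qed

text \<open>
  Contractivity of the representation is what allows the exponential series to be applied to \<open>e\<close>
  term by term.
\<close>

lemma representation_exp_eigenvector:
  assumes \<pi>: "star_representation \<pi>" and e: "\<pi> x e = t *\<^sub>C e"
  shows "\<pi> (exp x) e = exp t *\<^sub>C e"
proof -
  note repD = star_representationD[OF \<pi>]
  have pow: "\<pi> (x ^ n) e = t ^ n *\<^sub>C e" for n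
    by (induction n) (auto simp: repD e clinear_map_scaleC scaleC_scaleC mult.commute)
  have "\<pi> (x ^ n /\<^sub>R fact n) e = (t ^ n /\<^sub>R fact n) *\<^sub>C e" for n
    unfolding linear_simps(5)[OF bounded_linear_representation[OF \<pi>]] pow
    by (simp add: scaleC_of_real[symmetric] scaleC_scaleC scaleR_conv_of_real
      del: scaleC_of_real)
  moreover have "(\<lambda>n. \<pi> (x ^ n /\<^sub>R fact n) e) sums \<pi> (exp x) e"
    by (intro bounded_linear.sums[OF bounded_linear_representation[OF \<pi>]] exp_converges)
  moreover have "(\<lambda>n. (t ^ n /\<^sub>R fact n) *\<^sub>C e) sums (exp t *\<^sub>C e)"
    by (intro bounded_linear.sums[OF bounded_linear_scaleC_left] exp_converges)
  ultimately show ?thesis using sums_unique2 by simp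
qed

text \<open>
  The point \<open>t\<close> bisects the chord orthogonal to its radius, whose endpoints lie at the angles
  \<open>Arg t \<plusminus> arccos \<bar>t\<bar>\<close>.
\<close>

lemma unit_disc_midpoint:
  assumes "cmod t \<le> 1"
  obtains \<alpha> \<beta> where "t = (cis \<alpha> + cis \<beta>) / 2"
proof
  have "cos (arccos (cmod t)) = cmod t"
    using assms by (intro cos_arccos) (auto intro: order_trans[of _ 0])
  then have "cis (Arg t + arccos (cmod t)) + cis (Arg t - arccos (cmod t))
      = 2 * (complex_of_real (cmod t) * cis (Arg t))"
    by (simp add: complex_eq_iff cos_add sin_add cos_diff sin_diff algebra_simps)
  also have "complex_of_real (cmod t) * cis (Arg t) = t"
    using rcis_cmod_Arg[of t] by (simp add: rcis_def)
  finally show "t = (cis (Arg t + arccos (cmod t)) + cis (Arg t - arccos (cmod t))) / 2" by simp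
qed

section \<open>Algebras with simple joint spectrum\<close>

lemma topspace_weak_operator_topology: "topspace weak_operator_topology = bounded_operators"
  by (simp add: weak_operator_topology_def topspace_pullback_topology)

text \<open>
  Each basis vector \<open>e\<close> defines a character \<open>h \<mapsto> \<langle>\<pi>(h) e, e\<rangle>\<close> of \<open>M\<close>; the last assumption makes
  these characters pairwise different, so that all joint eigenspaces are one-dimensional.
\<close>

locale simple_spectrum =
  fixes M :: "'a::unital_cstar_algebra set" and \<pi> :: "'a \<Rightarrow> 'h::complex_hilbert_space \<Rightarrow> 'h"
    and B :: "'h set"
  assumes M: "cstar_subalgebra M" "1 \<in> M"
    and rep: "star_representation \<pi>"
    and basis: "orthonormal_basis B"
    and eigen: "h \<in> M \<Longrightarrow> e \<in> B \<Longrightarrow> \<exists>c. \<pi> h e = c *\<^sub>C e"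
    and separated: "e \<in> B \<Longrightarrow> f \<in> B \<Longrightarrow> e \<noteq> f \<Longrightarrow>
      \<exists>h\<in>M. cinner (\<pi> h e) e \<noteq> cinner (\<pi> h f) f"
begin

lemmas repD = star_representationD[OF rep]

lemmas M_closed = cstar_subalgebraD[OF M(1)]

lemma eigenvalue:
  assumes "h \<in> M" "e \<in> B"
  shows "\<pi> h e = cinner (\<pi> h e) e *\<^sub>C e"
  using eigen[OF assms] orthonormal_basis_cinner[OF basis assms(2,2)]
  by (auto simp: cinner_scaleC_left)

text \<open>
  As in Lagrange interpolation, \<open>g\<close> is a product of factors, one for each \<open>f \<in> F\<close>, that take the
  value 1 at \<open>e\<close> and 0 at \<open>f\<close>.
\<close>

lemma separating_element:
  assumes "finite F" "F \<subseteq> B" "e \<in> B" "e \<notin> F"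
  shows "\<exists>g\<in>M. \<pi> g e = e \<and> (\<forall>f\<in>F. \<pi> g f = 0)"
  using assms
proof (induction F)
  case empty
  show ?case using M(2) repD(4) by auto
next
  case (insert f F)
  then obtain g where g: "g \<in> M" "\<pi> g e = e" "\<forall>f\<in>F. \<pi> g f = 0" by auto
  obtain h where h: "h \<in> M" "cinner (\<pi> h e) e \<noteq> cinner (\<pi> h f) f"
    using separated[of e f] insert.prems by auto
  define s t where "s = cinner (\<pi> h e) e" and "t = cinner (\<pi> h f) f"
  have st: "\<pi> h e = s *\<^sub>C e" "\<pi> h f = t *\<^sub>C f" "s \<noteq> t"
    unfolding s_def t_def using eigenvalue[OF h(1)] insert.prems h(2) by auto
  define k where "k = (1 / (s - t)) *\<^sub>C (h - t *\<^sub>C 1)"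
  have k: "k \<in> M" unfolding k_def by (intro M_closed h M)
  have "\<pi> k e = (1 / (s - t)) *\<^sub>C (s *\<^sub>C e - t *\<^sub>C e)"
    by (simp add: k_def repD st)
  also have "s *\<^sub>C e - t *\<^sub>C e = (s - t) *\<^sub>C e"
    using scaleC_add_left[of "s - t" t e] by simp
  finally have ke: "\<pi> k e = e" using st(3) by (simp add: scaleC_scaleC)
  have kf: "\<pi> k f = 0" by (simp add: k_def repD st)
  have "\<pi> (g * k) f' = 0" if f': "f' \<in> F" for f'
  proof -
    obtain c where "\<pi> k f' = c *\<^sub>C f'" using eigen[OF k, of f'] f' insert.prems by auto
    then show ?thesis using f' g(3) by (simp add: repD clinear_map_scaleC[OF repD(2)])
  qed
  moreover have "\<pi> (g * k) e = e" "\<pi> (g * k) f = 0"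
    by (simp_all add: repD ke kf g(2) clinear_map_zero)
  moreover have "g * k \<in> M" by (intro M_closed g k)
  ultimately show ?case by auto
qed

lemma interpolation:
  assumes "finite F" "F \<subseteq> B"
  shows "\<exists>h\<in>M. \<forall>f\<in>F. \<pi> h f = t f *\<^sub>C f"
  using assms
proof (induction F)
  case empty
  show ?case using M(2) by auto
next
  case (insert e F)
  then obtain h where h: "h \<in> M" "\<forall>f\<in>F. \<pi> h f = t f *\<^sub>C f" by auto
  obtain g where g: "g \<in> M" "\<pi> g e = e" "\<forall>f\<in>F. \<pi> g f = 0"
    using separating_element[of F e] insert by auto
  obtain s where s: "\<pi> h e = s *\<^sub>C e" using eigen[OF h(1)] insert.prems by auto
  define k where "k = h + (t e - s) *\<^sub>C g"
  have "k \<in> M" unfolding k_def by (intro M_closed h g)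
  moreover have "\<pi> k e = t e *\<^sub>C e"
    using scaleC_add_left[of s "t e - s" e] by (simp add: k_def repD s g)
  moreover have "\<pi> k f = t f *\<^sub>C f" if "f \<in> F" for f
    using that h g by (simp add: k_def repD)
  ultimately show ?case by auto
qed

lemma selfadjoint_interpolation:
  assumes "finite F" "F \<subseteq> B"
  obtains a where "a \<in> M" "star a = a" "\<And>f. f \<in> F \<Longrightarrow> \<pi> a f = complex_of_real (\<theta> f) *\<^sub>C f"
proof -
  obtain p where p: "p \<in> M" "\<forall>f\<in>F. \<pi> p f = complex_of_real (\<theta> f) *\<^sub>C f"
    using interpolation[OF assms, of "\<lambda>f. complex_of_real (\<theta> f)"] by blast
  define a where "a = (1/2) *\<^sub>C (p + star p)"
  have "\<pi> a f = complex_of_real (\<theta> f) *\<^sub>C f" if f: "f \<in> F" for f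
  proof -
    have fB: "f \<in> B" using f assms by auto
    have "cinner (\<pi> (star p) f) f = cnj (cinner (\<pi> p f) f)"
      using repD(8)[of p f f] cinner_commute by metis
    also have "\<dots> = complex_of_real (\<theta> f)"
      using p(2) f orthonormal_basis_cinner[OF basis fB fB] by (simp add: cinner_scaleC_left)
    finally have "\<pi> (star p) f = complex_of_real (\<theta> f) *\<^sub>C f"
      using eigenvalue[OF M_closed(5)[OF p(1)] fB] by simp
    then show ?thesis
      using p(2) f by (simp add: a_def repD scaleC_scaleC flip: scaleC_add_left)
  qed
  moreover have "a \<in> M" unfolding a_def by (intro M_closed p)
  moreover have "star a = a"
    by (simp add: a_def star_scaleC star_add star_star add.commute)
  ultimately show ?thesis using that by blast
qed

text \<open>
  The point is that the bound \<open>K\<close> is that of \<open>T\<close>, whatever the size of \<open>F\<close>. The eigenvalues of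
  \<open>T\<close> lie in the disc of radius \<open>K\<close>, so they are \<open>K/2\<close> times a sum of two numbers of modulus 1,
  and it is enough to interpolate values of modulus 1 by unitaries \<open>exp (\<i> a)\<close>: these are
  isometric however large the selfadjoint element \<open>a\<close> is.
\<close>

lemma bounded_interpolation:
  assumes T: "T \<in> diagonal_operators B" and K: "K > 0" "\<And>x. norm (T x) \<le> K * norm x"
    and F: "finite F" "F \<subseteq> B"
  obtains h where "h \<in> M" "\<And>f. f \<in> F \<Longrightarrow> \<pi> h f = T f" "\<And>v. norm (\<pi> h v) \<le> K * norm v"
proof -
  have "\<exists>\<alpha> \<beta>. T f = (complex_of_real (K / 2) * (cis \<alpha> + cis \<beta>)) *\<^sub>C f" if f: "f \<in> B" for f
  proof -
    obtain t where t: "T f = t *\<^sub>C f" using T f unfolding diagonal_operators_def by blast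
    have "norm f = 1" using basis f by (auto simp: orthonormal_basis_def)
    then have "cmod (t / complex_of_real K) \<le> 1"
      using K(2)[of f] K(1) t by (simp add: norm_scaleC norm_divide)
    then obtain \<alpha> \<beta> where "t / complex_of_real K = (cis \<alpha> + cis \<beta>) / 2"
      by (rule unit_disc_midpoint)
    then have "t = complex_of_real (K / 2) * (cis \<alpha> + cis \<beta>)"
      using K(1) by (simp add: field_simps)
    then show ?thesis using t by blast
  qed
  then obtain \<alpha> \<beta> where ab: "\<And>f. f \<in> B \<Longrightarrow>
      T f = (complex_of_real (K / 2) * (cis (\<alpha> f) + cis (\<beta> f))) *\<^sub>C f"
    by metis
  have unitary: "\<exists>u\<in>M. (\<forall>v. norm (\<pi> u v) = norm v) \<and> (\<forall>f\<in>F. \<pi> u f = cis (\<theta> f) *\<^sub>C f)" for \<theta>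
  proof -
    obtain a where a: "a \<in> M" "star a = a"
      "\<And>f. f \<in> F \<Longrightarrow> \<pi> a f = complex_of_real (\<theta> f) *\<^sub>C f"
      by (rule selfadjoint_interpolation[OF F, of \<theta>]) blast
    let ?u = "exp (\<i> *\<^sub>C a)"
    have "?u \<in> M" by (intro exp_in_cstar_subalgebra M M_closed a)
    moreover have "norm (\<pi> ?u v) = norm v" for v
    proof -
      have "complex_of_real ((norm (\<pi> ?u v))\<^sup>2) = cinner (\<pi> (star ?u * ?u) v) v"
        by (metis cinner_self cinner_representation[OF rep])
      also have "\<dots> = complex_of_real ((norm v)\<^sup>2)"
        unfolding star_exp_ii_mult_self[OF a(2)] repD(4) by (rule cinner_self)
      finally have "(norm (\<pi> ?u v))\<^sup>2 = (norm v)\<^sup>2" unfolding of_real_eq_iff .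
      then show ?thesis by simp
    qed
    moreover have "\<pi> ?u f = cis (\<theta> f) *\<^sub>C f" if "f \<in> F" for f
    proof -
      have "\<pi> (\<i> *\<^sub>C a) f = (\<i> * complex_of_real (\<theta> f)) *\<^sub>C f"
        using a(3)[OF that] by (simp add: repD scaleC_scaleC)
      then have "\<pi> ?u f = exp (\<i> * complex_of_real (\<theta> f)) *\<^sub>C f"
        by (rule representation_exp_eigenvector[OF rep])
      then show ?thesis by (simp add: cis_conv_exp)
    qed
    ultimately show ?thesis by blast
  qed
  obtain u w where u: "u \<in> M" "\<And>v. norm (\<pi> u v) = norm v" "\<And>f. f \<in> F \<Longrightarrow> \<pi> u f = cis (\<alpha> f) *\<^sub>C f"
    and w: "w \<in> M" "\<And>v. norm (\<pi> w v) = norm v" "\<And>f. f \<in> F \<Longrightarrow> \<pi> w f = cis (\<beta> f) *\<^sub>C f"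
    using unitary[of \<alpha>] unitary[of \<beta>] by metis
  define h where "h = complex_of_real (K / 2) *\<^sub>C (u + w)"
  have "norm (\<pi> h v) \<le> K * norm v" for v
  proof -
    have "norm (\<pi> h v) = (K / 2) * norm (\<pi> u v + \<pi> w v)"
      unfolding h_def repD norm_scaleC norm_of_real using K(1) by simp
    also have "\<dots> \<le> (K / 2) * (norm (\<pi> u v) + norm (\<pi> w v))"
      using K(1) by (intro mult_left_mono norm_triangle_ineq) auto
    finally show ?thesis by (simp add: u w)
  qed
  moreover have "\<pi> h f = T f" if "f \<in> F" for f
    unfolding h_def repD u(3)[OF that] w(3)[OF that]
    using ab[of f] that F(2) by (auto simp: scaleC_scaleC scaleC_add_left[symmetric])
  moreover have "h \<in> M" unfolding h_def by (intro M_closed u w)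
  ultimately show ?thesis using that by blast
qed

text \<open>
  The vectors to be treated are given as a family \<open>g\<close>, so that each index may carry its own \<open>\<epsilon>\<close>
  even if vectors are repeated.
\<close>

lemma strong_approximation:
  assumes T: "T \<in> diagonal_operators B" and X: "finite X" and \<epsilon>: "\<And>x. x \<in> X \<Longrightarrow> \<epsilon> x > 0"
  obtains h where "h \<in> M" "\<And>x. x \<in> X \<Longrightarrow> norm (\<pi> h (g x) - T (g x)) < \<epsilon> x"
proof -
  have T': "T \<in> bounded_operators" using T by (simp add: diagonal_operators_def)
  then obtain K where K: "K > 0" "\<And>x. norm (T x) \<le> K * norm x"
    by (auto elim: bounded_operatorsE)
  have "\<forall>x\<in>X. \<exists>F. finite F \<and> F \<subseteq> B \<and> (\<forall>S \<in> bounded_operators.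
    (\<forall>f\<in>F. S f = T f) \<and> (\<forall>v. norm (S v) \<le> K * norm v) \<longrightarrow> norm (S (g x) - T (g x)) < \<epsilon> x)"
    using bounded_operators_close_if_agree_on_finite[OF basis T' K \<epsilon>] by blast
  then obtain F where F: "\<And>x. x \<in> X \<Longrightarrow> finite (F x)" "\<And>x. x \<in> X \<Longrightarrow> F x \<subseteq> B"
    "\<And>x S. x \<in> X \<Longrightarrow> S \<in> bounded_operators \<Longrightarrow> (\<forall>f\<in>F x. S f = T f)
      \<Longrightarrow> (\<forall>v. norm (S v) \<le> K * norm v) \<Longrightarrow> norm (S (g x) - T (g x)) < \<epsilon> x"
    by metis
  obtain h where h: "h \<in> M" "\<And>f. f \<in> (\<Union>x\<in>X. F x) \<Longrightarrow> \<pi> h f = T f"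
      "\<And>v. norm (\<pi> h v) \<le> K * norm v"
  proof (rule bounded_interpolation[OF T K])
    show "finite (\<Union>x\<in>X. F x)" "(\<Union>x\<in>X. F x) \<subseteq> B" using F X by auto
  qed blast
  show ?thesis
  proof (rule that[OF h(1)])
    fix x assume x: "x \<in> X"
    show "norm (\<pi> h (g x) - T (g x)) < \<epsilon> x"
      by (rule F(3)[OF x repD(1)]) (use h x in auto)
  qed
qed

lemma diagonal_operators_in_closure:
  assumes T: "T \<in> diagonal_operators B"
  shows "T \<in> weak_operator_topology closure_of (\<pi> ` M)"
  unfolding in_closure_of
proof (intro conjI allI impI, goal_cases)
  case 1
  show ?case using T by (simp add: topspace_weak_operator_topology diagonal_operators_def)
next
  case (2 U)
  then have TU: "T \<in> U" and U: "openin weak_operator_topology U" by auto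
  let ?c = "\<lambda>T. \<lambda>(x, y). cinner (T x) y"
  obtain V where V: "openin (product_topology (\<lambda>_. euclidean) UNIV) V"
    and UV: "U = ?c -` V \<inter> bounded_operators"
    using U by (auto simp: weak_operator_topology_def openin_pullback_topology)
  have "?c T \<in> V" using TU UV by auto
  then obtain W where W: "finite {i. W i \<noteq> topspace (euclidean :: complex topology)}"
    "\<And>i. open (W i)"
    "?c T \<in> PiE UNIV W" "PiE UNIV W \<subseteq> V"
    using V unfolding openin_product_topology_alt by auto
  \<comment> \<open>Only the finitely many matrix coefficients indexed by \<open>?J\<close> restrict the neighbourhood.\<close>
  let ?J = "{i. W i \<noteq> UNIV}"
  have "\<forall>i. \<exists>r>0. ball (?c T i) r \<subseteq> W i"
    using W(2,3) open_contains_ball by (metis PiE_mem UNIV_I)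
  then obtain r where r: "\<And>i. r i > 0" "\<And>i. ball (?c T i) (r i) \<subseteq> W i" by metis
  have "finite ?J" using W(1) by simp
  then obtain h where h: "h \<in> M"
    "\<And>i. i \<in> ?J \<Longrightarrow> norm (\<pi> h (fst i) - T (fst i)) < r i / (norm (snd i) + 1)"
    by (rule strong_approximation[OF T, where g = fst
      and \<epsilon> = "\<lambda>i. r i / (norm (snd i) + 1)"])
      (use r(1) in \<open>auto intro!: divide_pos_pos add_nonneg_pos\<close>)
  have "?c (\<pi> h) i \<in> W i" for i
  proof (cases "i \<in> ?J")
    case True
    obtain x y where i: "i = (x, y)" by (cases i)
    have "cmod (cinner (\<pi> h x - T x) y) \<le> norm (\<pi> h x - T x) * norm y" by (rule Cauchy_Schwarz)
    also have "\<dots> \<le> norm (\<pi> h x - T x) * (norm y + 1)" by (intro mult_left_mono) auto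
    also have "\<dots> < r i"
      using h(2)[OF True] i by (simp add: pos_less_divide_eq add_nonneg_pos)
    finally have "?c (\<pi> h) i \<in> ball (?c T i) (r i)"
      by (simp add: i dist_norm cinner_diff_left norm_minus_commute)
    then show ?thesis using r(2) by blast
  qed auto
  then have "?c (\<pi> h) \<in> V" using W(4) by auto
  then have "\<pi> h \<in> U" using UV repD(1) by auto
  then show ?case using h(1) by blast
qed

lemma closure_subset_diagonal_operators:
  "weak_operator_topology closure_of (\<pi> ` M) \<subseteq> diagonal_operators B"
proof
  fix T assume T: "T \<in> weak_operator_topology closure_of (\<pi> ` M)"
  have Tb: "T \<in> bounded_operators"
    using T by (simp add: in_closure_of topspace_weak_operator_topology)
  have "cinner (T e) f = 0" if ef: "e \<in> B" "f \<in> B" "e \<noteq> f" for e f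
  proof (rule ccontr)
    assume ne: "cinner (T e) f \<noteq> 0"
    let ?c = "\<lambda>T. \<lambda>(x, y). cinner (T x) y"
    let ?V = "{\<phi> \<in> topspace (product_topology (\<lambda>_. euclidean) UNIV). \<phi> (e, f) \<in> - {0 :: complex}}"
    have "openin (product_topology (\<lambda>_. euclidean) UNIV) ?V"
      by (rule openin_continuous_map_preimage[OF continuous_map_product_projection]) auto
    then have "openin weak_operator_topology (?c -` ?V \<inter> bounded_operators)"
      unfolding weak_operator_topology_def openin_pullback_topology by blast
    moreover have "T \<in> ?c -` ?V \<inter> bounded_operators" using ne Tb by auto
    ultimately obtain S where "S \<in> \<pi> ` M" "S \<in> ?c -` ?V \<inter> bounded_operators"
      using T unfolding in_closure_of by meson
    then obtain h where h: "h \<in> M" "cinner (\<pi> h e) f \<noteq> 0" by auto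
    then show False
      using eigen[OF h(1) ef(1)] orthonormal_basis_cinner[OF basis ef(1,2)] ef(3)
      by (auto simp: cinner_scaleC_left)
  qed
  then show "T \<in> diagonal_operators B" using diagonal_operators_iff[OF basis Tb] by blast
qed

lemma discrete_masa_closure: "discrete_masa (weak_operator_topology closure_of (\<pi> ` M))"
proof -
  have "weak_operator_topology closure_of (\<pi> ` M) = diagonal_operators B"
    using diagonal_operators_in_closure closure_subset_diagonal_operators by blast
  then show ?thesis
    using basis masa_diagonal_operators[OF basis] by (auto simp: discrete_masa_def)
qed

end

section \<open>Cartan pairs\<close>

text \<open>
  The eigenvalue \<open>t'\<close> of \<open>star h\<close> is the conjugate of \<open>t\<close> as soon as \<open>w \<noteq> 0\<close>, which is how a
  character of \<open>M\<close> with a joint eigenvector is seen to respect adjoints.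
\<close>

lemma eigenvectors_orthogonal:
  assumes \<pi>: "star_representation \<pi>"
    and v: "\<pi> h v = s *\<^sub>C v" and w: "\<pi> h w = t *\<^sub>C w" "\<pi> (star h) w = t' *\<^sub>C w" and "s \<noteq> t"
  shows "cinner v w = 0"
proof (cases "w = 0")
  case False
  have *: "cinner (\<pi> h u) w = cnj t' * cinner u w" for u
    by (simp add: star_representationD(8)[OF \<pi>] w cinner_scaleC_right)
  have "t * cinner w w = cnj t' * cinner w w"
    using *[of w] by (simp add: w cinner_scaleC_left)
  then have "t = cnj t'" using False by (simp add: cinner_self_eq_0)
  moreover have "s * cinner v w = cnj t' * cinner v w"
    using *[of v] by (simp add: v cinner_scaleC_left)
  ultimately show ?thesis using \<open>s \<noteq> t\<close> by simp
qed simp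

locale cartan_gns =
  fixes M :: "'a::unital_cstar_algebra set" and E :: "'a \<Rightarrow> 'a" and x\<^sub>0 :: "'a \<Rightarrow> complex"
    and \<pi> :: "'a \<Rightarrow> 'h::complex_hilbert_space \<Rightarrow> 'h" and \<xi> :: 'h
  assumes cartan: "cartan_pair M"
    and expectation: "conditional_expectation M E"
    and x0: "x\<^sub>0 \<in> characters M"
    and gns: "gns_representation (\<lambda>a. x\<^sub>0 (E a)) \<pi> \<xi>"
begin

lemma rep: "star_representation \<pi>"
  and vector_state: "cinner (\<pi> a \<xi>) \<xi> = x\<^sub>0 (E a)"
  and cyclic: "closure (range (\<lambda>a. \<pi> a \<xi>)) = UNIV"
  using gns by (auto simp: gns_representation_def)

lemmas repD = star_representationD[OF rep]

lemma M: "cstar_subalgebra M" "abelian M" "1 \<in> M" "maximal_abelian_cstar_subalgebra M"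
    "regular_subalgebra M"
  using cartan by (auto simp: cartan_pair_def maximal_abelian_cstar_subalgebra_def)

lemmas M_closed = cstar_subalgebraD[OF M(1)]

lemma M_commute: "x \<in> M \<Longrightarrow> y \<in> M \<Longrightarrow> x * y = y * x"
  using M by (auto simp: abelian_def)

lemma expectationD:
  "E a \<in> M" "h \<in> M \<Longrightarrow> E h = h"
  "h \<in> M \<Longrightarrow> E (h * a) = h * E a" "h \<in> M \<Longrightarrow> E (a * h) = E a * h"
  using expectation by (auto simp: conditional_expectation_def)

lemma character_one:
  assumes "y \<in> characters M" shows "y 1 = 1"
proof -
  obtain h where "h \<in> M" "y h \<noteq> 0" using assms by (auto simp: characters_def)
  moreover have "y (h * 1) = y h * y 1" using assms M(3) \<open>h \<in> M\<close> unfolding characters_def by blast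
  ultimately show ?thesis by simp
qed

lemma character:
  assumes "y \<in> characters M" "h \<in> M" "k \<in> M"
  shows "y (h + k) = y h + y k" "y (c *\<^sub>C h) = c * y h" "y (h * k) = y h * y k"
    "y (h - y h *\<^sub>C 1) = 0"
proof -
  have add: "y (h + k) = y h + y k" and scale: "y (c *\<^sub>C h) = c * y h" and mult: "y (h * k) = y h * y k"
    if "h \<in> M" "k \<in> M" for h k c
    using assms(1) that by (auto simp: characters_def)
  then show "y (h + k) = y h + y k" "y (c *\<^sub>C h) = c * y h" "y (h * k) = y h * y k"
    using assms by auto
  have eq: "h - y h *\<^sub>C 1 = h + (- y h) *\<^sub>C 1"
    using scaleC_add_left[of "y h" "- y h" "1::'a"] by (simp add: eq_neg_iff_add_eq_0 algebra_simps)
  show "y (h - y h *\<^sub>C 1) = 0"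
    unfolding eq using add scale M(3) M_closed(3) assms(2) character_one[OF assms(1)] by simp
qed

lemma norm_vector: "complex_of_real ((norm (\<pi> a \<xi>))\<^sup>2) = x\<^sub>0 (E (star a * a))"
  by (metis cinner_self cinner_representation[OF rep] vector_state)

lemma normalizerD:
  assumes "n \<in> normalizers M"
  shows "h \<in> M \<Longrightarrow> star n * h * n \<in> M" "h \<in> M \<Longrightarrow> n * h * star n \<in> M" "star n * n \<in> M" "n * star n \<in> M"
  using assms M(3) by (auto simp: normalizers_def)

text \<open>
  Both sides express that \<open>n\<^sup>* n (x\<^sub>0) = \<parallel>\<pi>(n)\<xi>\<parallel>\<^sup>2\<close> is different from 0.
\<close>

lemma alpha_dom_iff:
  assumes "n \<in> normalizers M"
  shows "x\<^sub>0 \<in> alpha_dom M n \<longleftrightarrow> \<pi> n \<xi> \<noteq> 0"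
proof -
  have "x\<^sub>0 (star n * n) = complex_of_real ((norm (\<pi> n \<xi>))\<^sup>2)"
    using norm_vector[of n] expectationD(2)[OF normalizerD(3)[OF assms]] by simp
  then show ?thesis
    using x0 by (simp add: alpha_dom_def topspace_gelfand_space less_complex_def)
qed

lemma alpha_character:
  assumes "n \<in> normalizers M" "\<pi> n \<xi> \<noteq> 0"
  shows "alpha M n x\<^sub>0 \<in> characters M" "alpha M n x\<^sub>0 (n * star n) \<noteq> 0"
    "h \<in> M \<Longrightarrow> x\<^sub>0 (star n * h * n) = alpha M n x\<^sub>0 h * x\<^sub>0 (star n * n)"
    "x\<^sub>0 (star n * n) \<noteq> 0"
  using alpha_eq[OF M(1-3) assms(1), of x\<^sub>0] alpha_dom_iff[OF assms(1)] assms(2)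
  by (auto simp: alpha_ran_def alpha_dom_def topspace_gelfand_space)

text \<open>
  With \<open>y = \<alpha>\<^sub>n(x\<^sub>0)\<close> and \<open>k = h - y(h)\<close>, the square of the norm of \<open>\<pi>(k)\<pi>(n)\<xi>\<close> is \<open>(n\<^sup>* k\<^sup>* k
  n)(x\<^sub>0) = y(k\<^sup>*) y(k) n\<^sup>* n (x\<^sub>0)\<close>, and \<open>y(k) = 0\<close>.
\<close>

lemma normalizer_vector_eigenvector:
  assumes n: "n \<in> normalizers M" "\<pi> n \<xi> \<noteq> 0" and h: "h \<in> M"
  shows "\<pi> h (\<pi> n \<xi>) = alpha M n x\<^sub>0 h *\<^sub>C \<pi> n \<xi>"
proof -
  let ?y = "alpha M n x\<^sub>0"
  note y = alpha_character[OF n]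
  define k where "k = h - ?y h *\<^sub>C 1"
  have k: "k \<in> M" unfolding k_def by (intro M_closed M h)
  have "complex_of_real ((norm (\<pi> (k * n) \<xi>))\<^sup>2) = x\<^sub>0 (E (star n * (star k * k) * n))"
    unfolding norm_vector by (simp add: star_mult mult.assoc)
  also have "\<dots> = x\<^sub>0 (star n * (star k * k) * n)"
    by (simp add: expectationD(2) normalizerD[OF n(1)] M_closed k)
  also have "\<dots> = ?y (star k * k) * x\<^sub>0 (star n * n)"
    by (intro y M_closed k)
  also have "?y (star k * k) = ?y (star k) * ?y k"
    by (intro character y M_closed k)
  also have "?y k = 0" unfolding k_def by (rule character[OF y(1) h h])
  finally have "\<pi> (k * n) \<xi> = 0" by simp
  then show ?thesis by (simp add: k_def repD)
qed

lemma cyclic_vector_eigenvector: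
  assumes h: "h \<in> M"
  shows "\<pi> h \<xi> = x\<^sub>0 h *\<^sub>C \<xi>"
proof -
  define k where "k = h - x\<^sub>0 h *\<^sub>C 1"
  have k: "k \<in> M" unfolding k_def by (intro M_closed M h)
  have "x\<^sub>0 k = 0" unfolding k_def by (rule character[OF x0 h h])
  then have "complex_of_real ((norm (\<pi> k \<xi>))\<^sup>2) = 0"
    unfolding norm_vector by (simp add: expectationD(2) M_closed k character[OF x0])
  then have "\<pi> k \<xi> = 0" by simp
  then show ?thesis by (simp add: k_def repD)
qed

text \<open>
  Applying \<open>E\<close> to \<open>k (k\<^sup>* h k) = h k (k\<^sup>* k)\<close> gives \<open>E(k) (k\<^sup>* h k) = E(k) h (k\<^sup>* k)\<close>, the
  algebraic form of the fact that \<open>\<alpha>\<^sub>k\<close> is the identity on the part of its domain where \<open>E(k) \<noteq>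
  0\<close>. From this the C*-identity shows that \<open>k E(k)\<close> commutes with each \<open>h \<in> M\<close>: for the
  commutator \<open>X\<close> of \<open>h\<close> and \<open>k\<close>, the four terms of \<open>X\<^sup>* X E(k)\<close> cancel.
\<close>

lemma normalizer_times_expectation_in_M:
  assumes k: "k \<in> normalizers M"
  shows "k * E k \<in> M"
proof -
  define e where "e = E k"
  have e: "e \<in> M" unfolding e_def by (rule expectationD)
  define q where "q h = star k * h * k" for h
  have q: "q h \<in> M" if "h \<in> M" for h unfolding q_def using that normalizerD[OF k] by blast
  have q1: "q 1 = star k * k" by (simp add: q_def)
  have q_e: "q h * e = h * q 1 * e" if h: "h \<in> M" for h
  proof -
    have "k * q h = (k * star k) * h * k" by (simp add: q_def mult.assoc)
    also have "(k * star k) * h = h * (k * star k)" by (intro M_commute normalizerD[OF k] h)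
    also have "h * (k * star k) * k = h * (k * q 1)" by (simp add: q1 mult.assoc)
    finally have "e * q h = h * (e * q 1)"
      unfolding e_def by (metis expectationD(3,4) q h M(3))
    then show ?thesis by (metis M_commute e q h M(3) mult.assoc)
  qed
  have "h * (k * e) = (k * e) * h" if h: "h \<in> M" for h
  proof -
    define X where "X = h * k - k * h"
    have X: "star X * X = q (star h * h) - q (star h) * h - star h * q h + star h * q 1 * h"
      by (simp add: X_def q_def star_diff star_mult algebra_simps)
    have "q (star h * h) * e = star h * h * q 1 * e" by (intro q_e M_closed h)
    moreover have "q (star h) * h * e = star h * h * q 1 * e"
    proof -
      have "q (star h) * h * e = h * (q (star h) * e)"
        using M_commute[OF q[OF M_closed(5)[OF h]] h] by (simp add: mult.assoc)
      also have "\<dots> = h * star h * q 1 * e" by (simp add: q_e M_closed h mult.assoc)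
      also have "h * star h = star h * h" by (intro M_commute M_closed h)
      finally show ?thesis .
    qed
    moreover have "star h * q h * e = star h * h * q 1 * e"
      using q_e[OF h] by (simp add: mult.assoc)
    moreover have "star h * q 1 * h * e = star h * h * q 1 * e"
      using M_commute[OF q[OF M(3)] h] by (simp add: mult.assoc)
    ultimately have "star X * X * e = 0" unfolding X by (simp add: algebra_simps)
    then have "star (X * e) * (X * e) = 0" by (simp add: star_mult mult.assoc)
    then have "X * e = 0" using cstar_identity[of "X * e"] by simp
    then have "h * (k * e) = k * (h * e)" by (simp add: X_def algebra_simps)
    then show ?thesis using M_commute[OF h e] by (simp add: mult.assoc)
  qed
  then have "k * e \<in> commutant M" by (simp add: commutant_def)
  then show ?thesis using commutant_maximal_abelian_subset[OF M(4)] by (auto simp: e_def)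
qed

text \<open>
  Since \<open>k E(k)\<close> lies in \<open>M\<close>, it equals its expectation \<open>E(k)\<^sup>2\<close>; apply both to \<open>\<xi>\<close>, an
  eigenvector of \<open>\<pi>(E(k))\<close>, and divide by the eigenvalue.
\<close>

lemma normalizer_vector_proportional_cyclic:
  assumes k: "k \<in> normalizers M" and ne: "x\<^sub>0 (E k) \<noteq> 0"
  shows "\<pi> k \<xi> = x\<^sub>0 (E k) *\<^sub>C \<xi>"
proof -
  let ?c = "x\<^sub>0 (E k)"
  have "k * E k = E k * E k"
    using expectationD(2)[OF normalizer_times_expectation_in_M[OF k]]
      expectationD(4)[OF expectationD(1)] by metis
  then have "\<pi> k (\<pi> (E k) \<xi>) = \<pi> (E k) (\<pi> (E k) \<xi>)" by (metis repD(7))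
  then have "?c *\<^sub>C \<pi> k \<xi> = ?c *\<^sub>C ?c *\<^sub>C \<xi>"
    by (simp add: cyclic_vector_eigenvector expectationD(1) clinear_map_scaleC[OF repD(2)])
  then have "(1 / ?c) *\<^sub>C ?c *\<^sub>C \<pi> k \<xi> = (1 / ?c) *\<^sub>C ?c *\<^sub>C ?c *\<^sub>C \<xi>" by simp
  then show ?thesis using ne by (simp add: scaleC_scaleC)
qed

text \<open>
  The normalizer \<open>k = m\<^sup>* n\<close> moves \<open>x\<^sub>0\<close> to the common point \<open>y\<close> and back. Trivial isotropy then
  provides \<open>E(k)(x\<^sub>0) \<noteq> 0\<close>, so \<open>\<pi>(k)\<xi>\<close> is a multiple of \<open>\<xi>\<close>; on the other hand \<open>\<pi>(m)\<pi>(k)\<xi> = \<pi>(m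
  m\<^sup>*)\<pi>(n)\<xi> = y(m m\<^sup>*) \<pi>(n)\<xi>\<close> with \<open>y(m m\<^sup>*) \<noteq> 0\<close>.
\<close>

lemma normalizer_vectors_proportional:
  assumes triv: "trivial_isotropy M E x\<^sub>0"
    and n: "n \<in> normalizers M" "\<pi> n \<xi> \<noteq> 0" and m: "m \<in> normalizers M" "\<pi> m \<xi> \<noteq> 0"
    and same: "alpha M n x\<^sub>0 = alpha M m x\<^sub>0"
  shows "\<exists>c. \<pi> n \<xi> = c *\<^sub>C \<pi> m \<xi>"
proof -
  let ?y = "alpha M n x\<^sub>0"
  note y = alpha_character[OF n]
  have ym: "?y (m * star m) \<noteq> 0" using alpha_character(2)[OF m] same by simp
  define k where "k = star m * n"
  have kk: "star k * h * k = star n * (m * h * star m) * n" for h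
    by (simp add: k_def star_mult star_star mult.assoc)
  have x_k: "x\<^sub>0 (star k * h * k) = ?y (m * h * star m) * x\<^sub>0 (star n * n)" if "h \<in> M" for h
    unfolding kk using that by (intro y normalizerD[OF m(1)])
  have x_kk: "x\<^sub>0 (star k * k) = ?y (m * star m) * x\<^sub>0 (star n * n)"
    using x_k[OF M(3)] by simp
  have "x\<^sub>0 (0 *\<^sub>C 1) = 0 * x\<^sub>0 1" by (rule character(2)[OF x0 M(3) M(3)])
  then have "x\<^sub>0 0 = 0" by simp
  then have "k \<noteq> 0" using x_kk ym y(4) by auto
  then have k: "k \<in> normalizers M"
    using normalizers_mult[OF star_normalizer[OF m(1)] n(1)] by (simp add: k_def)
  have "\<pi> k \<xi> \<noteq> 0"
    using norm_vector[of k] x_kk ym y(4) expectationD(2)[OF normalizerD(3)[OF k]] by auto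
  then have k_dom: "x\<^sub>0 \<in> alpha_dom M k" using alpha_dom_iff[OF k] by simp
  have y_dom: "?y \<in> alpha_dom M (star m)"
    using alpha_eq(2)[OF M(1-3) m(1)] m alpha_dom_iff[OF m(1)]
    by (simp add: same alpha_dom_def alpha_ran_def star_star)
  have "alpha M (star m) ?y = x\<^sub>0"
    using alpha_star_alpha[OF M(1-3) m(1)] m alpha_dom_iff[OF m(1)] by (simp add: same)
  then have y_m: "?y (m * h * star m) = x\<^sub>0 h * ?y (m * star m)" if "h \<in> M" for h
    using alpha_eq(3)[OF M(1-3) star_normalizer[OF m(1)] y_dom that] by (simp add: star_star)
  have "alpha M k x\<^sub>0 = x\<^sub>0"
  proof (rule extensionalityI[where A = M])
    show "alpha M k x\<^sub>0 \<in> extensional M" by (simp add: alpha_eq(1)[OF M(1-3) k k_dom])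
    show "x\<^sub>0 \<in> extensional M" using x0 by (simp add: characters_def)
    fix h assume "h \<in> M"
    then show "alpha M k x\<^sub>0 h = x\<^sub>0 h"
      using ym y(4) by (simp add: alpha_eq(1)[OF M(1-3) k k_dom] x_k x_kk y_m)
  qed
  then have "x\<^sub>0 (E k) \<noteq> 0"
    using triv k k_dom by (auto simp: trivial_isotropy_def nontrivial_isotropy_def)
  then have "\<pi> k \<xi> = x\<^sub>0 (E k) *\<^sub>C \<xi>" by (rule normalizer_vector_proportional_cyclic[OF k])
  then have "\<pi> m (\<pi> k \<xi>) = x\<^sub>0 (E k) *\<^sub>C \<pi> m \<xi>" by (simp add: clinear_map_scaleC[OF repD(2)])
  moreover have "\<pi> m (\<pi> k \<xi>) = \<pi> (m * star m) (\<pi> n \<xi>)" by (simp add: k_def repD)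
  moreover have "\<dots> = ?y (m * star m) *\<^sub>C \<pi> n \<xi>"
    by (intro normalizer_vector_eigenvector n normalizerD[OF m(1)])
  ultimately have "(1 / ?y (m * star m)) *\<^sub>C ?y (m * star m) *\<^sub>C \<pi> n \<xi>
      = (1 / ?y (m * star m)) *\<^sub>C x\<^sub>0 (E k) *\<^sub>C \<pi> m \<xi>" by simp
  then show ?thesis using ym by (auto simp: scaleC_scaleC)
qed

lemma normalizer_vectors_total:
  assumes S: "csubspace S" "closed S" "\<And>n. n \<in> normalizers M \<Longrightarrow> \<pi> n \<xi> \<in> S"
  shows "S = UNIV"
proof -
  let ?A = "(\<lambda>a. \<pi> a \<xi>) -` S"
  have "csubspace ?A"
    using csubspaceD[OF S(1)] repD linear_simps(3)[OF bounded_linear_representation[OF rep]]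
    by (auto simp: csubspace_def)
  moreover have "closed ?A"
    by (intro closed_vimage S linear_continuous_on bounded_linear_representation rep)
  ultimately have "a \<in> ?A" for a
    using S(3) by (intro regular_closed_csubspace[OF M(5)]) auto
  then have "closure (range (\<lambda>a. \<pi> a \<xi>)) \<subseteq> S" using S(2) by (intro closure_minimal) auto
  then show ?thesis using cyclic by auto
qed

text \<open>
  The basis is indexed by the orbit \<open>Y\<close> of \<open>x\<^sub>0\<close>: the function \<open>r\<close> picks a normalizer that moves
  \<open>x\<^sub>0\<close> to a given point. By proportionality every \<open>\<pi>(n)\<xi>\<close> is a multiple of a picked vector, so
  the span stays dense.
\<close>

lemma simple_spectrum_basis:
  assumes triv: "trivial_isotropy M E x\<^sub>0"
  obtains B where "simple_spectrum M \<pi> B"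
proof -
  define N where "N = {n \<in> normalizers M. \<pi> n \<xi> \<noteq> 0}"
  let ?\<alpha> = "\<lambda>n. alpha M n x\<^sub>0"
  define r where "r = inv_into N ?\<alpha>"
  define u where "u n = (1 / complex_of_real (norm (\<pi> n \<xi>))) *\<^sub>C \<pi> n \<xi>" for n
  define Y where "Y = ?\<alpha> ` N"
  define B where "B = (\<lambda>y. u (r y)) ` Y"
  have r: "r y \<in> N" "?\<alpha> (r y) = y" if "y \<in> Y" for y
    using that inv_into_into[of y ?\<alpha> N] f_inv_into_f[of y ?\<alpha> N] by (auto simp: r_def Y_def)
  have norm_u: "norm (u n) = 1" if "n \<in> N" for n
    using that by (simp add: u_def N_def norm_scaleC norm_divide)
  have eigen_u: "\<pi> h (u n) = ?\<alpha> n h *\<^sub>C u n" if "n \<in> N" "h \<in> M" for n h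
    using that normalizer_vector_eigenvector[of n h]
    by (simp add: u_def N_def clinear_map_scaleC[OF repD(2)] scaleC_scaleC mult.commute)
  have u_u: "cinner (u n) (u n) = 1" if "n \<in> N" for n
    using norm_u[OF that] by (simp add: cinner_self)
  have distinct: "\<exists>h\<in>M. y h \<noteq> y' h" if "y \<in> Y" "y' \<in> Y" "y \<noteq> y'" for y y'
  proof -
    have "y \<in> extensional M" "y' \<in> extensional M"
      using that alpha_character(1) by (auto simp: N_def Y_def characters_def)
    then show ?thesis using that(3) extensionalityI[of y M y'] by blast
  qed
  have orthogonal: "cinner (u (r y)) (u (r y')) = 0"
    if y: "y \<in> Y" "y' \<in> Y" "y \<noteq> y'" for y y'
  proof -
    obtain h where h: "h \<in> M" "y h \<noteq> y' h" using distinct[OF y] by blast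
    show ?thesis
      by (rule eigenvectors_orthogonal[OF rep, of h _ "y h" _ "y' h" "y' (star h)"])
        (use h y r eigen_u M_closed in auto)
  qed
  have "closure (csubspace hull B) = UNIV"
  proof (rule normalizer_vectors_total)
    have sub: "csubspace (csubspace hull B)"
      by (rule hull_in) (auto simp: csubspace_def)
    then show S: "csubspace (closure (csubspace hull B))" by (rule csubspace_closure)
    fix n assume n: "n \<in> normalizers M"
    show "\<pi> n \<xi> \<in> closure (csubspace hull B)"
    proof (cases "n \<in> N")
      case False
      then show ?thesis using n csubspaceD(1)[OF S] by (simp add: N_def)
    next
      case True
      let ?m = "r (?\<alpha> n)"
      have m: "?m \<in> N" "?\<alpha> ?m = ?\<alpha> n" "?\<alpha> n \<in> Y" using r True by (auto simp: Y_def)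
      then obtain c where "\<pi> n \<xi> = c *\<^sub>C \<pi> ?m \<xi>"
        using normalizer_vectors_proportional[OF triv, of n ?m] True by (auto simp: N_def)
      also have "\<pi> ?m \<xi> = complex_of_real (norm (\<pi> ?m \<xi>)) *\<^sub>C u ?m"
        using m by (simp add: u_def scaleC_scaleC N_def)
      finally have "\<pi> n \<xi> \<in> csubspace hull B"
        using m(3) hull_subset[of B csubspace]
        by (simp only:) (intro csubspaceD(3)[OF sub], auto simp: B_def)
      then show ?thesis using closure_subset by blast
    qed
  qed simp
  moreover have "norm e = 1" if "e \<in> B" for e
    using that norm_u r(1) by (auto simp: B_def)
  moreover have "cinner e f = 0" if "e \<in> B" "f \<in> B" "e \<noteq> f" for e f
  proof -
    obtain y y' where "y \<in> Y" "y' \<in> Y" "e = u (r y)" "f = u (r y')" "y \<noteq> y'"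
      using \<open>e \<in> B\<close> \<open>f \<in> B\<close> \<open>e \<noteq> f\<close> by (auto simp: B_def)
    then show ?thesis using orthogonal by simp
  qed
  ultimately have "orthonormal_basis B" by (simp add: orthonormal_basis_def)
  then have "simple_spectrum M \<pi> B"
  proof (unfold_locales, goal_cases)
    case (5 h e)
    then show ?case using eigen_u r by (auto simp: B_def)
  next
    case (6 e f)
    then obtain y y' where y: "y \<in> Y" "y' \<in> Y" "e = u (r y)" "f = u (r y')" "y \<noteq> y'"
      by (auto simp: B_def)
    then obtain h where "h \<in> M" "y h \<noteq> y' h" using distinct by blast
    then show ?case using y r eigen_u u_u by (auto simp: cinner_scaleC_left intro!: bexI[of _ h])
  qed (use M rep in auto)
  then show ?thesis by (rule that)
qed

end

theorem corollary8:
  fixes M :: "'a::unital_cstar_algebra set" and E :: "'a \<Rightarrow> 'a"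
    and x\<^sub>0 :: "'a \<Rightarrow> complex"
    and \<pi>\<^sub>0 :: "'a \<Rightarrow> 'h::complex_hilbert_space \<Rightarrow> 'h" and \<xi>\<^sub>0 :: 'h
  assumes "cartan_pair M"
    and "faithful_conditional_expectation M E"
    and "x\<^sub>0 \<in> topspace (gelfand_space M)"
    and "trivial_isotropy M E x\<^sub>0"
    and "gns_representation (\<lambda>a. x\<^sub>0 (E a)) \<pi>\<^sub>0 \<xi>\<^sub>0"
  shows "discrete_masa (weak_operator_topology closure_of (\<pi>\<^sub>0 ` M))"
proof -
  interpret cartan_gns M E x\<^sub>0 \<pi>\<^sub>0 \<xi>\<^sub>0
    using assms by unfold_locales
      (auto simp: faithful_conditional_expectation_def topspace_gelfand_space)
  obtain B where "simple_spectrum M \<pi>\<^sub>0 B"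
    using assms(4) by (rule simple_spectrum_basis)
  then show ?thesis by (rule simple_spectrum.discrete_masa_closure)
qed

end
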